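(* Let $q$ be an odd prime power, $d\ge 2$, $k\ge 1$ an integer, $\phi:\mathbb{F}_q^d\times\mathbb{F}_q^d\to\mathbb{F}_q$ a distance type function, $t\in\mathbb{F}_q^*$, and $A\subseteq\mathbb{F}_q^d$. Let $\mathcal{P}_k$ denote the number of embeddings of a path of length $k$ in $A$ with respect to $\phi$. If $$|A|>\frac{2k}{\ln 2}\,q^{\frac{d+1}{2}},$$ then $$\left|\mathcal{P}_k-\frac{|A|^{k+1}}{q^k}\right|\ \le\ \frac{2k}{\ln 2}\,q^{\frac{d+1}{2}}\,\frac{|A|^k}{q^k}.$$
   Context: A distance type function is a function $\phi:\mathbb{F}_q^d\times\mathbb{F}_q^d\to\mathbb{F}_q$ that is either a non-degenerate bilinear form, or of the form $\phi(x,y)=Q(x-y)$ for a non-degenerate quadratic form $Q$ on $\mathbb{F}_q^d$. For a fixed nonzero distance $t\in\mathbb{F}_q^*$, the number $\mathcal{P}_k$ of embeddings of a path of length $k$ (that is, with $k$ edges) in $A$ is the number of tuples $(x_1,\dots,x_{k+1})\in A^{k+1}$ with $\phi(x_i,x_{i+1})=t$ for all $1\le i\le k$. The points $x_i$ are not required to be distinct. *)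

theory Defs
  imports "HOL-Analysis.Analysis"
begin

text \<open>The space $\mathbb{F}_q^d$ is rendered as \<^typ>\<open>'a ^ 'n\<close> for a finite field \<open>'a\<close> with \<open>q\<close> elements
  and a finite index type \<open>'n\<close> with \<open>d\<close> elements; it is a vector space over \<open>'a\<close> via \<open>(*s)\<close>.\<close>

definition bilinear_form :: "('a::field ^ 'n \<Rightarrow> 'a ^ 'n \<Rightarrow> 'a) \<Rightarrow> bool" where
  "bilinear_form B \<longleftrightarrow>
     (\<forall>y. Vector_Spaces.linear (*s) (*) (\<lambda>x. B x y)) \<and>
     (\<forall>x. Vector_Spaces.linear (*s) (*) (\<lambda>y. B x y))"

text \<open>Bilinear forms are not assumed symmetric, so both radicals are required to vanish.\<close>

definition nondegenerate_form :: "('a::field ^ 'n \<Rightarrow> 'a ^ 'n \<Rightarrow> 'a) \<Rightarrow> bool" where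
  "nondegenerate_form B \<longleftrightarrow>
     (\<forall>x. (\<forall>y. B x y = 0) \<longrightarrow> x = 0) \<and> (\<forall>y. (\<forall>x. B x y = 0) \<longrightarrow> y = 0)"

definition polar_form :: "('a::field ^ 'n \<Rightarrow> 'a) \<Rightarrow> 'a ^ 'n \<Rightarrow> 'a ^ 'n \<Rightarrow> 'a" where
  "polar_form Q x y = Q (x + y) - Q x - Q y"

definition quadratic_form :: "('a::field ^ 'n \<Rightarrow> 'a) \<Rightarrow> bool" where
  "quadratic_form Q \<longleftrightarrow> (\<forall>c x. Q (c *s x) = c\<^sup>2 * Q x) \<and> bilinear_form (polar_form Q)"

text \<open>The polar form is twice the symmetric bilinear form \<open>B\<close> with \<open>Q x = B x x\<close>; the factor does
  not affect non-degeneracy in odd characteristic.\<close>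

definition nondegenerate_quadratic_form :: "('a::field ^ 'n \<Rightarrow> 'a) \<Rightarrow> bool" where
  "nondegenerate_quadratic_form Q \<longleftrightarrow> quadratic_form Q \<and> nondegenerate_form (polar_form Q)"

definition distance_type :: "('a::field ^ 'n \<Rightarrow> 'a ^ 'n \<Rightarrow> 'a) \<Rightarrow> bool" where
  "distance_type \<phi> \<longleftrightarrow>
     (bilinear_form \<phi> \<and> nondegenerate_form \<phi>) \<or>
     (\<exists>Q. nondegenerate_quadratic_form Q \<and> \<phi> = (\<lambda>x y. Q (x - y)))"

text \<open>A tuple $(x_1,\dots,x_{k+1})$ is a list of length \<open>k + 1\<close>, indexed from 0.\<close>

definition path_embeddings ::
    "('v \<Rightarrow> 'v \<Rightarrow> 'a) \<Rightarrow> 'a \<Rightarrow> 'v set \<Rightarrow> nat \<Rightarrow> 'v list set" where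
  "path_embeddings \<phi> t A k =
     {xs. length xs = k + 1 \<and> set xs \<subseteq> A \<and> (\<forall>i<k. \<phi> (xs ! i) (xs ! (i + 1)) = t)}"

definition num_paths :: "('v \<Rightarrow> 'v \<Rightarrow> 'a) \<Rightarrow> 'a \<Rightarrow> 'v set \<Rightarrow> nat \<Rightarrow> nat" where
  "num_paths \<phi> t A k = card (path_embeddings \<phi> t A k)"

end

theory Submission
  imports Defs "HOL-Algebra.Algebraic_Closure_Type" "HOL-Number_Theory.Cong"
begin

text \<open>
  Write \<open>N\<close> for the cardinality of \<open>A\<close>. The relation \<open>\<phi> x y = t\<close> is a graph on the whole space
  whose adjacency operator is \<open>J/q + M\<close>, where \<open>J\<close> is the all-ones operator and \<open>M\<close> has operator norm at
  most \<open>\<Lambda> = 2 q^((d-1)/2)\<close> (\<open>distance_operator_bound\<close>). Compressed to functions supported on \<open>A\<close>, the first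
  summand has norm \<open>a = N/q\<close> and maps the indicator of \<open>A\<close> to \<open>a\<close> times itself. The number of paths is a
  matrix coefficient of the \<open>k\<close>-th power of the compressed operator at this indicator, so expanding that
  power leaves the main term \<open>N a^k\<close> and an error of at most \<open>N ((a + \<Lambda>)^k - a^k)\<close>. Here
  \<open>\<Lambda>/a = 2 q^((d+1)/2)/N\<close>; the hypothesis on \<open>N\<close> says \<open>k \<Lambda>/a < ln 2\<close>, and on \<open>[0, ln 2]\<close> the convex
  function \<open>e^v - 1\<close> lies below its chord \<open>v / ln 2\<close>. This is where the constant comes from.

  For a bilinear form the norm of \<open>M\<close> is computed by Parseval's identity, applied on the space and on every line
  through the origin. For \<open>\<phi> x y = Q (x - y)\<close> the operator is a convolution, so its eigenvalues are the Fourier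
  coefficients of the level set \<open>Q = t\<close>. Expanding the condition \<open>Q h = t\<close> in additive characters and completing
  the square turns such a coefficient into a sum of \<open>\<psi>(a s + b/s) G(s)\<close> over nonzero \<open>s\<close>, where \<open>G(s)\<close> is the Gauss sum of
  \<open>s Q\<close>. Its modulus is \<open>q^(d/2)\<close>, and \<open>G\<close> is either constant or proportional to the quadratic character. In
  the second case one meets a Salie sum, which has a closed form; in the first case a Kloosterman sum, for which
  Weil's bound \<open>2 \<surd>q\<close> is required.

  Weil's bound is proved in an algebraic closure of the field. Let \<open>K n\<close> be the Kloosterman sum over the extension of
  degree \<open>n\<close>. Stepanov's method (\<open>card_trace_fibre_le\<close>) gives \<open>norm (K (2 m)) \<le> C q^m\<close> with \<open>C\<close> depending
  on \<open>q\<close> only. On the other hand \<open>K (2 n) = 2 q^n - (K n)^2\<close> (\<open>kloosterman_double\<close>). If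
  \<open>norm (K 1)\<close> exceeded \<open>2 \<surd>q\<close>, iterating this relation would make the quotients
  \<open>norm (K (2^j)) / \<surd>q^(2^j)\<close> grow without bound. So the estimate with an unspecified constant, over all these
  extensions, already yields the sharp constant over the ground field.
\<close>

section \<open>Linear relations between polynomials\<close>

text \<open>
  Gaussian elimination, one equation at a time: either the last equation is void, or one unknown is expressed
  through the others.
\<close>
lemma homogeneous_system_nontrivial_solution:
  fixes f :: "'i \<Rightarrow> nat \<Rightarrow> 'k::field"
  assumes "finite I" "card I > E"
  shows "\<exists>c. (\<exists>i\<in>I. c i \<noteq> 0) \<and> (\<forall>j<E. (\<Sum>i\<in>I. c i * f i j) = 0)"
  using assms
proof (induction E arbitrary: I f)
  case 0
  then obtain i where "i \<in> I" by fastforce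
  then show ?case by (intro exI[of _ "\<lambda>_. 1"]) auto
next
  case (Suc E)
  show ?case
  proof (cases "\<forall>i\<in>I. f i E = 0")
    case True
    obtain c where c: "\<exists>i\<in>I. c i \<noteq> 0" "\<forall>j<E. (\<Sum>i\<in>I. c i * f i j) = 0"
      using Suc.IH[of I f] Suc.prems by auto
    have "(\<Sum>i\<in>I. c i * f i E) = 0" using True by simp
    then show ?thesis using c less_Suc_eq by (intro exI[of _ c]) auto
  next
    case False
    then obtain i0 where i0: "i0 \<in> I" "f i0 E \<noteq> 0" by auto
    define I' where "I' = I - {i0}"
    have I': "finite I'" "card I' > E" "I = insert i0 I'" "i0 \<notin> I'"
      using Suc.prems i0 by (auto simp: I'_def)
    define g where "g i j = f i j - f i E / f i0 E * f i0 j" for i j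
    obtain c where c: "\<exists>i\<in>I'. c i \<noteq> 0" "\<forall>j<E. (\<Sum>i\<in>I'. c i * g i j) = 0"
      using Suc.IH[OF I'(1,2), of g] by auto
    define e where "e = - (\<Sum>i\<in>I'. c i * f i E) / f i0 E"
    define c' where "c' = c(i0 := e)"
    have c': "(\<Sum>i\<in>I. c' i * f i j) = (\<Sum>i\<in>I'. c i * g i j)" for j
    proof -
      have "(\<Sum>i\<in>I. c' i * f i j) = e * f i0 j + (\<Sum>i\<in>I'. c' i * f i j)"
        using I' by (simp add: c'_def)
      also have "(\<Sum>i\<in>I'. c' i * f i j) = (\<Sum>i\<in>I'. c i * f i j)"
        using I'(4) by (intro sum.cong) (auto simp: c'_def)
      also have "e * f i0 j = - (\<Sum>i\<in>I'. c i * (f i E / f i0 E * f i0 j))"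
        by (simp add: e_def sum_distrib_right sum_distrib_left sum_divide_distrib mult_ac)
      also have "\<dots> + (\<Sum>i\<in>I'. c i * f i j) = (\<Sum>i\<in>I'. c i * g i j)"
        by (simp add: g_def right_diff_distrib sum_subtractf)
      finally show ?thesis .
    qed
    have "(\<Sum>i\<in>I. c' i * f i j) = 0" if "j < Suc E" for j
    proof (cases "j = E")
      case True
      have "g i E = 0" for i using i0 by (simp add: g_def)
      then show ?thesis using True by (simp add: c')
    next
      case False
      then show ?thesis using that c(2) by (simp add: c')
    qed
    moreover have "\<exists>i\<in>I. c' i \<noteq> 0"
      using c(1) I'(3,4) by (auto simp: c'_def)
    ultimately show ?thesis by blast
  qed
qed

text \<open>
  Distinct degrees force independence: the top coefficient of the highest term that occurs cannot cancel.
\<close>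
lemma poly_combination_nonzero:
  fixes P :: "nat \<Rightarrow> 'k::field poly"
  assumes deg: "\<And>n. n < N \<Longrightarrow> P n \<noteq> 0 \<and> Polynomial.degree (P n) = n + d"
    and c: "\<exists>n<N. c n \<noteq> 0"
  shows "(\<Sum>n<N. Polynomial.smult (c n) (P n)) \<noteq> 0"
proof -
  define n where "n = Max {n. n < N \<and> c n \<noteq> 0}"
  have fin: "finite {n. n < N \<and> c n \<noteq> 0}" by auto
  have "n \<in> {n. n < N \<and> c n \<noteq> 0}"
    unfolding n_def using c by (intro Max_in) auto
  then have n: "n < N" "c n \<noteq> 0" by auto
  have max: "i \<le> n" if "i < N" "c i \<noteq> 0" for i
    unfolding n_def using that by (intro Max_ge[OF fin]) auto
  have zero: "Polynomial.coeff (Polynomial.smult (c i) (P i)) (n + d) = 0" if "i < N" "i \<noteq> n" for i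
  proof (cases "c i = 0")
    case False
    then have "i < n" using max[of i] that by auto
    then show ?thesis using deg[OF that(1)] by (simp add: coeff_eq_0)
  qed simp
  have "Polynomial.coeff (\<Sum>i<N. Polynomial.smult (c i) (P i)) (n + d)
      = (\<Sum>i<N. Polynomial.coeff (Polynomial.smult (c i) (P i)) (n + d))"
    by (rule coeff_sum)
  also have "\<dots> = Polynomial.coeff (Polynomial.smult (c n) (P n)) (n + d)"
  proof -
    have "(\<Sum>i\<in>{..<N} - {n}. Polynomial.coeff (Polynomial.smult (c i) (P i)) (n + d)) = 0"
      by (intro sum.neutral ballI zero) auto
    then show ?thesis using n by (subst sum.remove[of _ n]) auto
  qed
  also have "\<dots> \<noteq> 0"
    using deg[OF n(1)] n(2) leading_coeff_0_iff[of "P n"] by simp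
  finally show ?thesis by auto
qed

section \<open>Kloosterman sums in an algebraically closed field\<close>

text \<open>
  All the extensions of a field with \<open>q\<close> elements live inside one algebraically closed field, as the fixed sets
  of the powers of the Frobenius map. This makes induction along the tower of extensions possible within one type. The
  hypotheses on \<open>psi\<close> make it a character of the ground field, the set of fixed points of the \<open>q\<close>-th power map.
\<close>
locale frobenius_character =
  fixes q :: nat and psi :: "'l::alg_closed_field \<Rightarrow> complex"
  assumes q_ge_2: "q \<ge> 2"
    and of_nat_q: "of_nat q = (0 :: 'l)"
    and two_neq_zero: "(2 :: 'l) \<noteq> 0"
    and frobenius_add_1: "\<And>x y :: 'l. (x + y) ^ q = x ^ q + y ^ q"
    and psi_add: "\<And>x y. x ^ q = x \<Longrightarrow> y ^ q = y \<Longrightarrow> psi (x + y) = psi x * psi y"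
    and norm_psi: "\<And>x. x ^ q = x \<Longrightarrow> norm (psi x) = 1"
    and psi_nontrivial: "\<exists>z. z ^ q = z \<and> psi z \<noteq> 1"
begin

text \<open>
  \<open>Fq n\<close> is the subfield with \<open>q^n\<close> elements, and \<open>tr n\<close> restricted to it is the trace to the ground field. Outside
  \<open>Fq n\<close>, \<open>tr n\<close> is a partial trace: it is used in that way for the subfield of index two below.
\<close>
definition Fq :: "nat \<Rightarrow> 'l set" where
  "Fq n = {x. x ^ (q ^ n) = x}"

definition tr :: "nat \<Rightarrow> 'l \<Rightarrow> 'l" where
  "tr n x = (\<Sum>i<n. x ^ (q ^ i))"

definition kloosterman :: "nat \<Rightarrow> 'l \<Rightarrow> 'l \<Rightarrow> complex" where
  "kloosterman n a b = (\<Sum>x\<in>Fq n - {0}. psi (tr n (a * x + b / x)))"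

lemma q_pos: "q > 0" and q_pow_pos: "q ^ n > 0"
  using q_ge_2 by auto

lemma frobenius_add: "(x + y :: 'l) ^ (q ^ n) = x ^ (q ^ n) + y ^ (q ^ n)"
proof (induction n)
  case (Suc n)
  have "(x + y) ^ (q ^ Suc n) = ((x + y) ^ (q ^ n)) ^ q"
    by (simp only: power_Suc2 power_mult)
  also have "\<dots> = (x ^ (q ^ n)) ^ q + (y ^ (q ^ n)) ^ q"
    using Suc frobenius_add_1 by simp
  finally show ?case by (simp only: power_Suc2 power_mult)
qed simp

lemma frobenius_sum: "(\<Sum>i\<in>I. f i :: 'l) ^ (q ^ n) = (\<Sum>i\<in>I. f i ^ (q ^ n))"
  using q_pow_pos[of n] by (induction I rule: infinite_finite_induct) (auto simp: frobenius_add)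

lemma frobenius_minus: "(- x :: 'l) ^ (q ^ n) = - (x ^ (q ^ n))"
proof -
  have "x ^ (q ^ n) + (- x) ^ (q ^ n) = (x + - x) ^ (q ^ n)" by (simp only: frobenius_add)
  also have "\<dots> = 0" using q_pow_pos[of n] by simp
  finally show ?thesis by (simp add: add_eq_0_iff)
qed

lemma frobenius_diff: "(x - y :: 'l) ^ (q ^ n) = x ^ (q ^ n) - y ^ (q ^ n)"
  using frobenius_add[of x "- y" n] frobenius_minus[of y n] by simp

lemma frobenius_iterate: "(x ^ (q ^ i)) ^ (q ^ j) = (x :: 'l) ^ (q ^ (i + j))"
  by (simp add: power_add power_mult)

lemma Fq_mono_1: assumes "x \<in> Fq 1" shows "x \<in> Fq n"
proof -
  have "x ^ (q ^ n) = x"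
  proof (induction n)
    case (Suc n)
    have "x ^ (q ^ Suc n) = (x ^ (q ^ n)) ^ (q ^ 1)" using frobenius_iterate[of x n 1] by (metis Suc_eq_plus1)
    then show ?case using Suc assms by (simp add: Fq_def)
  qed simp
  then show ?thesis by (simp add: Fq_def)
qed

lemma Fq_closed:
  shows "0 \<in> Fq n" "1 \<in> Fq n"
    and "x \<in> Fq n \<Longrightarrow> y \<in> Fq n \<Longrightarrow> x + y \<in> Fq n"
    and "x \<in> Fq n \<Longrightarrow> y \<in> Fq n \<Longrightarrow> x - y \<in> Fq n"
    and "x \<in> Fq n \<Longrightarrow> y \<in> Fq n \<Longrightarrow> x * y \<in> Fq n"
    and "x \<in> Fq n \<Longrightarrow> y \<in> Fq n \<Longrightarrow> x / y \<in> Fq n"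
    and "x \<in> Fq n \<Longrightarrow> - x \<in> Fq n"
  using q_pow_pos[of n]
  by (auto simp: Fq_def frobenius_add frobenius_diff frobenius_minus power_mult_distrib power_divide)

lemma Fq_power_closed: "x \<in> Fq n \<Longrightarrow> x ^ k \<in> Fq n"
  by (induction k) (auto intro: Fq_closed)

lemma card_Fq:
  assumes "n \<ge> 1"
  shows "finite (Fq n)" "card (Fq n) = q ^ n"
proof -
  define Q where "Q = q ^ n"
  have Q: "Q \<ge> 2" using q_ge_2 assms by (metis One_nat_def Q_def Suc_leD le_trans numeral_2_eq_2 one_le_power power_increasing power_one_right)
  have of_nat_Q: "of_nat Q = (0 :: 'l)" using assms of_nat_q q_pos by (simp add: Q_def)
  define P where "P = Polynomial.monom (1 :: 'l) Q - [:0, 1:]"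
  have deg: "Polynomial.degree P = Q"
    unfolding P_def using Q
    by (subst diff_conv_add_uminus, subst degree_add_eq_left) (auto simp: degree_monom_eq)
  then have P0: "P \<noteq> 0" using Q by auto
  have root: "poly P x = 0 \<longleftrightarrow> x \<in> Fq n" for x
    by (simp add: P_def poly_monom Fq_def Q_def)
  have pderiv: "pderiv P = - 1"
    by (simp add: P_def pderiv_diff pderiv_monom of_nat_Q pderiv_pCons one_pCons)
  have fin: "finite (Fq n)" using poly_roots_finite[OF P0] by (simp add: root)
  obtain A where A: "size A = Polynomial.degree P"
    "P = Polynomial.smult (Polynomial.lead_coeff P) (\<Prod>x\<in>#A. [:-x, 1:])"
    using alg_closed_imp_factorization[OF P0] by blast
  have set_A: "set_mset A = Fq n"
  proof -
    have "poly P x = Polynomial.lead_coeff P * (\<Prod>y\<in>#A. x - y)" for x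
      by (subst A(2)) (simp add: poly_prod_mset image_mset.compositionality o_def)
    then have "poly P x = 0 \<longleftrightarrow> x \<in># A" for x using P0 by (auto simp: image_iff)
    then show ?thesis using root by auto
  qed
  \<comment> \<open>The derivative is a nonzero constant, so no root is repeated.\<close>
  have "count A x = 1" if "x \<in># A" for x
  proof (rule ccontr)
    assume "count A x \<noteq> 1"
    moreover have "count A x > 0" using that by simp
    ultimately have "count A x \<ge> 2" by linarith
    then have "{#x, x#} \<subseteq># A" by (auto simp: subseteq_mset_def)
    then obtain B where "A = {#x, x#} + B" by (auto simp: subset_mset.le_iff_add)
    then have "P = [:-x, 1:] * ([:-x, 1:] * Polynomial.smult (Polynomial.lead_coeff P) (\<Prod>x\<in>#B. [:-x, 1:]))"
      by (subst A(2)) (simp add: mult_ac)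
    then obtain R where R: "P = [:-x, 1:] * ([:-x, 1:] * R)" by blast
    have "poly (pderiv P) x = 0" by (subst R) (simp only: pderiv_mult poly_add poly_mult, simp)
    then show False by (simp add: pderiv)
  qed
  then have "A = mset_set (Fq n)"
    by (intro multiset_eqI) (metis count_eq_zero_iff count_mset_set(1,3) fin set_A)
  then have "card (Fq n) = Q" using A(1) deg by simp
  then show "finite (Fq n)" "card (Fq n) = q ^ n" using fin by (auto simp: Q_def)
qed

lemma tr_add: "tr n (x + y) = tr n x + tr n y"
  by (simp add: tr_def frobenius_add sum.distrib)

lemma tr_in_Fq_1:
  assumes "x \<in> Fq n" shows "tr n x \<in> Fq 1"
proof -
  have "tr n x ^ (q ^ 1) = (\<Sum>i<n. x ^ (q ^ Suc i))"
    unfolding tr_def frobenius_sum frobenius_iterate by simp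
  also have "\<dots> = tr n x"
  proof (cases n)
    case (Suc k)
    have "(\<Sum>i<n. x ^ (q ^ Suc i)) = (\<Sum>i<k. x ^ (q ^ Suc i)) + x ^ (q ^ n)"
      using Suc by simp
    also have "x ^ (q ^ n) = x ^ (q ^ 0)" using assms by (simp add: Fq_def)
    also have "(\<Sum>i<k. x ^ (q ^ Suc i)) + x ^ (q ^ 0) = tr n x"
      unfolding tr_def Suc sum.lessThan_Suc_shift by (simp add: add.commute)
    finally show ?thesis .
  qed (simp add: tr_def)
  finally show ?thesis by (simp add: Fq_def)
qed

lemma tr_double: "tr (2 * n) x = tr n x + tr n x ^ (q ^ n)"
proof -
  have "tr (2 * n) x = tr n x + (\<Sum>i=n..<n+n. x ^ (q ^ i))"
    unfolding tr_def mult_2 by (simp add: lessThan_atLeast0 sum.atLeastLessThan_concat)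
  also have "(\<Sum>i=n..<n+n. x ^ (q ^ i)) = (\<Sum>i=0..<n. x ^ (q ^ (i + n)))"
    using sum.shift_bounds_nat_ivl[of "\<lambda>i. x ^ (q ^ i)" 0 n n] by simp
  also have "\<dots> = tr n x ^ (q ^ n)"
    by (simp add: tr_def frobenius_sum frobenius_iterate lessThan_atLeast0)
  finally show ?thesis .
qed

lemma tr_frobenius: "tr n (x ^ (q ^ m)) = tr n x ^ (q ^ m)"
  by (simp add: tr_def frobenius_sum frobenius_iterate add.commute)

lemma psi_tr_add:
  "x \<in> Fq n \<Longrightarrow> y \<in> Fq n \<Longrightarrow> psi (tr n (x + y)) = psi (tr n x) * psi (tr n y)"
  using tr_in_Fq_1[of x n] tr_in_Fq_1[of y n] by (simp add: tr_add psi_add Fq_def)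

lemma psi_sum_eq_0:
  assumes "z \<in> Fq n" "psi (tr n z) \<noteq> 1" "c \<in> Fq n" "c \<noteq> 0"
  shows "(\<Sum>x\<in>Fq n. psi (tr n (x * c))) = 0"
proof -
  define w where "w = z / c"
  have w: "w \<in> Fq n" using assms Fq_closed by (simp add: w_def)
  have "(\<Sum>x\<in>Fq n. psi (tr n (x * c))) = (\<Sum>x\<in>Fq n. psi (tr n ((x + w) * c)))"
    by (rule sum.reindex_bij_witness[of _ "\<lambda>x. x + w" "\<lambda>x. x - w"]) (use w Fq_closed in auto)
  also have "\<dots> = (\<Sum>x\<in>Fq n. psi (tr n (x * c)) * psi (tr n z))"
  proof (rule sum.cong)
    fix x assume "x \<in> Fq n"
    then show "psi (tr n ((x + w) * c)) = psi (tr n (x * c)) * psi (tr n z)"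
      using assms Fq_closed(5)[of x n c] psi_tr_add[of "x * c" n z] by (simp add: distrib_right w_def)
  qed simp
  also have "\<dots> = (\<Sum>x\<in>Fq n. psi (tr n (x * c))) * psi (tr n z)"
    by (simp add: sum_distrib_right)
  finally show ?thesis using assms(2) by simp
qed

text \<open>
  On the ground field the trace from degree \<open>2^j\<close> is multiplication by \<open>2^j\<close>, which is invertible in
  odd characteristic; so \<open>psi\<close> remains nontrivial when it is lifted by the trace.
\<close>
lemma psi_tr_nontrivial: "\<exists>z\<in>Fq (2 ^ j). psi (tr (2 ^ j) z) \<noteq> 1"
proof -
  obtain z where z: "z ^ q = z" "psi z \<noteq> 1" using psi_nontrivial by blast
  define w where "w = z / 2 ^ j"
  have "2 \<in> Fq 1" using Fq_closed(3)[OF Fq_closed(2) Fq_closed(2), of 1] by simp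
  then have "w \<in> Fq 1" unfolding w_def using z(1) by (intro Fq_closed(6) Fq_power_closed) (auto simp: Fq_def)
  then have w: "w \<in> Fq i" for i by (rule Fq_mono_1)
  have "tr (2 ^ j) w = (\<Sum>i<(2::nat) ^ j. w)"
    unfolding tr_def using w by (intro sum.cong) (auto simp: Fq_def)
  also have "\<dots> = z" using two_neq_zero by (simp add: w_def)
  finally show ?thesis using w z(2) by (intro bexI[of _ w]) auto
qed

text \<open>
  The monic quadratic polynomial whose roots \<open>u\<close>, \<open>v\<close> have sum \<open>e1\<close> and product \<open>e2\<close> either splits over the small
  field or has a pair of conjugate roots in its quadratic extension. In the first case the ordered pairs are
  \<open>(u, v)\<close> and \<open>(v, u)\<close>, in the second the elements of given trace and norm are \<open>u\<close> and \<open>v\<close>; a double root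
  contributes once to each count. The total is always two.
\<close>
lemma card_split_plus_card_conjugate:
  assumes e1: "e1 \<in> Fq n" and e2: "e2 \<in> Fq n" "e2 \<noteq> 0" and "n \<ge> 1"
  shows "card {(x, y). x \<in> Fq n - {0} \<and> y \<in> Fq n - {0} \<and> x + y = e1 \<and> x * y = e2}
       + card {z. z \<in> Fq (2 * n) - {0} \<and> z + z ^ (q ^ n) = e1 \<and> z * z ^ (q ^ n) = e2} = 2"
    (is "card ?A + card ?B = 2")
proof -
  let ?s = "\<lambda>z :: 'l. z ^ (q ^ n)"
  have "Polynomial.degree [:e2, - e1, 1:] > 0" by simp
  then obtain u where u: "poly [:e2, - e1, 1:] u = 0"
    using alg_closed_imp_poly_has_root by blast
  define v where "v = e1 - u"
  have uv: "u + v = e1" "u * v = e2"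
    using u by (auto simp: v_def algebra_simps add_eq_0_iff)
  have uv0: "u \<noteq> 0" "v \<noteq> 0" using uv e2 by auto
  have root: "z = u \<or> z = v" if "z + w = e1" "z * w = e2" for z w
  proof -
    have "(z - u) * (z - v) = z * z - (u + v) * z + u * v" by (simp add: algebra_simps)
    also have "\<dots> = z * z - (z + w) * z + z * w" by (simp only: uv that)
    also have "\<dots> = 0" by (simp add: algebra_simps)
    finally show ?thesis by auto
  qed
  have s_e1: "?s e1 = e1" and s_e2: "?s e2 = e2" using e1 e2 by (auto simp: Fq_def)
  show ?thesis
  proof (cases "u \<in> Fq n")
    case True
    then have v: "v \<in> Fq n" using e1 Fq_closed by (simp add: v_def)
    have A: "?A = {(u, v), (v, u)}"
    proof (intro Set.set_eqI iffI)
      fix p assume "p \<in> ?A"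
      then obtain x y where p: "p = (x, y)" "x + y = e1" "x * y = e2" by auto
      then show "p \<in> {(u, v), (v, u)}" using root[of x y] uv(1) by auto
    qed (use True v uv uv0 in \<open>auto simp: add.commute mult.commute\<close>)
    have B: "?B = (if u = v then {u} else {})"
    proof (intro Set.set_eqI iffI)
      fix z assume z: "z \<in> ?B"
      then have zuv: "z = u \<or> z = v" using root by blast
      then have "?s z = z" using True v by (auto simp: Fq_def)
      then have "z + z = u + v" using z uv(1) by simp
      with zuv have "z = u \<and> u = v" by (metis add_left_cancel add_right_cancel)
      then show "z \<in> (if u = v then {u} else {})" by simp
    next
      fix z assume "z \<in> (if u = v then {u} else {})"
      then have z: "z = u" "u = v" by (auto split: if_splits)
      have s: "?s u = u" using True by (simp add: Fq_def)
      have "u ^ (q ^ (n + n)) = ?s (?s u)" by (simp only: frobenius_iterate)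
      then have "u \<in> Fq (2 * n)" by (simp only: s Fq_def mult_2 mem_Collect_eq)
      moreover have "u + ?s u = e1" "u * ?s u = e2" unfolding s using uv z(2) by simp_all
      ultimately show "z \<in> ?B" using z(1) uv0 by simp
    qed
    show ?thesis unfolding A B by auto
  next
    case False
    have "?s u + ?s v = e1" "?s u * ?s v = e2"
      using s_e1 s_e2 uv by (metis frobenius_add, metis power_mult_distrib)
    then have "?s u = v" "?s v = u"
      using root[of "?s u" "?s v"] False uv by (auto simp: Fq_def)
    then have conj: "?s u = v" "?s v = u" by auto
    have "u \<noteq> v" using conj False by (auto simp: Fq_def)
    have v: "v \<notin> Fq n" using conj \<open>u \<noteq> v\<close> by (auto simp: Fq_def)
    have A: "?A = {}" using root False v by blast
    have "u ^ (q ^ (n + n)) = ?s (?s u)" "v ^ (q ^ (n + n)) = ?s (?s v)"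
      by (simp_all only: frobenius_iterate)
    then have "u \<in> Fq (2 * n)" "v \<in> Fq (2 * n)"
      by (simp_all only: conj Fq_def mult_2 mem_Collect_eq)
    moreover have "u + ?s u = e1" "u * ?s u = e2" "v + ?s v = e1" "v * ?s v = e2"
      unfolding conj using uv by (simp_all add: add.commute mult.commute)
    ultimately have "u \<in> ?B" "v \<in> ?B"
      using uv0 by simp_all
    moreover have "?B \<subseteq> {u, v}" using root by blast
    ultimately have B: "?B = {u, v}" by blast
    show ?thesis unfolding A B using \<open>u \<noteq> v\<close> by simp
  qed
qed

text \<open>
  The square of the sum over the small field runs over pairs \<open>(x, y)\<close>, the sum over the large field over
  elements \<open>z\<close> with conjugate \<open>z'\<close>. Both summands depend only on \<open>e1 = x + y\<close>, \<open>e2 = x y\<close> (respectively on trace and norm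
  of \<open>z\<close>), because \<open>1/x + 1/y = e1/e2\<close>. By the previous count, the two sums together take every \<open>(e1, e2)\<close>
  with \<open>e2 \<noteq> 0\<close> exactly twice; summing over \<open>e1\<close> first leaves only \<open>e2 = -b/a\<close>.
\<close>
lemma kloosterman_double:
  assumes n: "n \<ge> 1" and nontriv: "z \<in> Fq n" "psi (tr n z) \<noteq> 1"
    and a: "a \<in> Fq n" "a \<noteq> 0" and b: "b \<in> Fq n" "b \<noteq> 0"
  shows "kloosterman (2 * n) a b = 2 * of_nat (q ^ n) - (kloosterman n a b)\<^sup>2"
proof -
  let ?s = "\<lambda>z :: 'l. z ^ (q ^ n)"
  define F where "F = Fq n"
  define F0 where "F0 = Fq n - {0}"
  define E0 where "E0 = Fq (2 * n) - {0}"
  define T where "T = F \<times> F0"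
  define g where "g = (\<lambda>(e1, e2). psi (tr n (a * e1 + b * e1 / e2)))"
  define inv1 where "inv1 = (\<lambda>(x, y). (x + y, x * y :: 'l))"
  define inv2 where "inv2 = (\<lambda>z. (z + ?s z, z * ?s z))"
  have fin: "finite F" "finite F0" "finite E0" "finite T"
    using card_Fq[of n] card_Fq[of "2 * n"] n by (auto simp: F_def F0_def E0_def T_def)
  have "(kloosterman n a b)\<^sup>2 = (\<Sum>x\<in>F0. \<Sum>y\<in>F0. psi (tr n (a * x + b / x)) * psi (tr n (a * y + b / y)))"
    unfolding kloosterman_def power2_eq_square sum_product F0_def ..
  also have "\<dots> = (\<Sum>p\<in>F0 \<times> F0. g (inv1 p))"
    unfolding sum.cartesian_product
  proof (intro sum.cong refl, clarify)
    fix x y assume xy: "x \<in> F0" "y \<in> F0"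
    have "a * x + b / x \<in> Fq n" "a * y + b / y \<in> Fq n"
      using xy a b Fq_closed by (auto simp: F0_def)
    then have "psi (tr n (a * x + b / x)) * psi (tr n (a * y + b / y))
        = psi (tr n ((a * x + b / x) + (a * y + b / y)))" by (simp only: psi_tr_add)
    also have "(a * x + b / x) + (a * y + b / y) = a * (x + y) + b * (x + y) / (x * y)"
      using xy by (simp add: F0_def field_simps)
    finally show "psi (tr n (a * x + b / x)) * psi (tr n (a * y + b / y)) = g (inv1 (x, y))"
      by (simp add: g_def inv1_def)
  qed
  also have "\<dots> = (\<Sum>e\<in>T. \<Sum>p | p \<in> F0 \<times> F0 \<and> inv1 p = e. g (inv1 p))"
    by (rule sum.group[symmetric])
       (use fin Fq_closed in \<open>auto simp: T_def F_def F0_def inv1_def\<close>)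
  also have "\<dots> = (\<Sum>e\<in>T. of_nat (card {p \<in> F0 \<times> F0. inv1 p = e}) * g e)"
    by (intro sum.cong refl) simp
  finally have K1: "(kloosterman n a b)\<^sup>2 = (\<Sum>e\<in>T. of_nat (card {p \<in> F0 \<times> F0. inv1 p = e}) * g e)" .
  have "kloosterman (2 * n) a b = (\<Sum>z\<in>E0. g (inv2 z))"
    unfolding kloosterman_def E0_def
  proof (rule sum.cong)
    fix z assume z: "z \<in> Fq (2 * n) - {0}"
    have sab: "?s a = a" "?s b = b" using a b by (auto simp: Fq_def)
    have "tr (2 * n) (a * z + b / z) = tr n ((a * z + b / z) + ?s (a * z + b / z))"
      by (simp only: tr_add[of n _ "?s _"] tr_double tr_frobenius)
    also have "?s (a * z + b / z) = a * ?s z + b / ?s z"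
      by (simp add: frobenius_add power_mult_distrib power_divide sab)
    also have "(a * z + b / z) + (a * ?s z + b / ?s z) = a * (z + ?s z) + b * (z + ?s z) / (z * ?s z)"
      using z by (simp add: field_simps)
    finally show "psi (tr (2 * n) (a * z + b / z)) = g (inv2 z)" by (simp add: g_def inv2_def)
  qed simp
  also have "\<dots> = (\<Sum>e\<in>T. \<Sum>z | z \<in> E0 \<and> inv2 z = e. g (inv2 z))"
  proof (rule sum.group[symmetric])
    show "inv2 ` E0 \<subseteq> T"
    proof (rule image_subsetI)
      fix z assume z: "z \<in> E0"
      then have "?s (?s z) = z" unfolding frobenius_iterate by (simp add: E0_def Fq_def mult_2)
      then show "inv2 z \<in> T" using z
        by (auto simp: inv2_def T_def F_def F0_def E0_def Fq_def frobenius_add power_mult_distrib add.commute mult.commute)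
    qed
  qed (use fin in auto)
  also have "\<dots> = (\<Sum>e\<in>T. of_nat (card {z \<in> E0. inv2 z = e}) * g e)"
    by (intro sum.cong refl) simp
  finally have K2: "kloosterman (2 * n) a b = (\<Sum>e\<in>T. of_nat (card {z \<in> E0. inv2 z = e}) * g e)" .
  have "(kloosterman n a b)\<^sup>2 + kloosterman (2 * n) a b
      = (\<Sum>e\<in>T. of_nat (card {p \<in> F0 \<times> F0. inv1 p = e} + card {z \<in> E0. inv2 z = e}) * g e)"
    unfolding K1 K2 by (simp add: sum.distrib distrib_right)
  also have "\<dots> = (\<Sum>e\<in>T. 2 * g e)"
  proof (rule sum.cong)
    fix e assume "e \<in> T"
    then obtain e1 e2 where e: "e = (e1, e2)" "e1 \<in> Fq n" "e2 \<in> Fq n" "e2 \<noteq> 0"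
      by (auto simp: T_def F_def F0_def)
    have "{p \<in> F0 \<times> F0. inv1 p = e}
        = {(x, y). x \<in> Fq n - {0} \<and> y \<in> Fq n - {0} \<and> x + y = e1 \<and> x * y = e2}"
      by (auto simp: inv1_def e(1) F0_def)
    moreover have "{z \<in> E0. inv2 z = e}
        = {z. z \<in> Fq (2 * n) - {0} \<and> z + ?s z = e1 \<and> z * ?s z = e2}"
      by (auto simp: inv2_def e(1) E0_def)
    ultimately have "card {p \<in> F0 \<times> F0. inv1 p = e} + card {z \<in> E0. inv2 z = e} = 2"
      using card_split_plus_card_conjugate[OF e(2,3,4) n] by simp
    then show "of_nat (card {p \<in> F0 \<times> F0. inv1 p = e} + card {z \<in> E0. inv2 z = e}) * g e = 2 * g e"
      by simp
  qed simp
  also have "\<dots> = 2 * (\<Sum>e2\<in>F0. \<Sum>e1\<in>F. psi (tr n (e1 * (a + b / e2))))"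
    unfolding T_def sum_distrib_left sum.cartesian_product
    by (rule sum.reindex_bij_witness[of _ prod.swap prod.swap])
       (auto simp: g_def algebra_simps)
  also have "(\<Sum>e2\<in>F0. \<Sum>e1\<in>F. psi (tr n (e1 * (a + b / e2))))
      = (\<Sum>e2\<in>F0. if e2 = - b / a then of_nat (q ^ n) else 0)"
  proof (rule sum.cong)
    fix e2 assume e2: "e2 \<in> F0"
    show "(\<Sum>e1\<in>F. psi (tr n (e1 * (a + b / e2)))) = (if e2 = - b / a then of_nat (q ^ n) else 0)"
    proof (cases "e2 = - b / a")
      case True
      have "psi (tr n 0) = 1"
        using psi_tr_add[of 0 n 0] Fq_closed(1)[of n] norm_psi[of "tr n 0"] tr_in_Fq_1[of 0 n]
        by (auto simp: Fq_def)
      moreover have "a + b / e2 = 0" using True a b by simp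
      ultimately show ?thesis using True card_Fq[OF n] by (simp add: F_def)
    next
      case False
      have "a + b / e2 \<noteq> 0"
      proof
        assume "a + b / e2 = 0"
        then have "a * e2 + b = 0" using e2 by (simp add: F0_def field_simps)
        then have "e2 = - b / a" using a by (simp add: field_simps add_eq_0_iff2)
        then show False using False by simp
      qed
      moreover have "a + b / e2 \<in> Fq n" using a b e2 Fq_closed by (simp add: F0_def)
      ultimately show ?thesis using False psi_sum_eq_0[OF nontriv] by (simp add: F_def)
    qed
  qed simp
  also have "\<dots> = of_nat (q ^ n)"
  proof -
    have "- b / a \<in> F0" using a b Fq_closed by (simp add: F0_def)
    then show ?thesis using fin by simp
  qed
  finally show ?thesis by (simp add: algebra_simps)
qed

text \<open>
  Stepanov's method. Put \<open>r = q^m\<close>, \<open>s = r/q\<close>, \<open>f x = a x + b/x\<close> and \<open>h x = tr m (f x)\<close>. On the fibre,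
  \<open>x^(r r) = x\<close> and \<open>h x ^ r = c - h x\<close>. Consider the functions \<open>x^i (x^r)^k (h x)^l\<close> with
  \<open>i < s\<close>, \<open>l < q\<close>, \<open>k < s + 2\<close>. Since \<open>h\<close> has degree \<open>s\<close> at infinity, their degrees
  \<open>i + s l + r k\<close> are the mixed-radix expansions of the numbers below \<open>r (s + 2)\<close>, so the functions are
  independent. On the fibre the \<open>r\<close>-th power of such a function equals \<open>x^(r i + k) (c - h x)^l\<close>, and these
  functions span a space of dimension only about \<open>r s + r\<close>. Hence there is a relation among them, and taking
  \<open>r\<close>-th roots of its coefficients gives a nonzero combination \<open>H\<close> of the original functions that vanishes on the
  fibre. The degree of \<open>H\<close> bounds the number of points.

  Below, everything is multiplied by \<open>x^(s (q - 1))\<close> to clear the pole at zero: \<open>hp\<close> is \<open>x^s h\<close>, and \<open>P n\<close>,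
  \<open>R n\<close> are the two families, indexed by \<open>n = i + s l + r k\<close>.
\<close>
lemma card_trace_fibre_le:
  assumes m: "m \<ge> 1" and a: "a \<in> Fq 1" "a \<noteq> 0" and b: "b \<in> Fq 1" and c: "c \<in> Fq 1"
  shows "card {x \<in> Fq (2 * m) - {0}. tr (2 * m) (a * x + b / x) = c} \<le> q ^ (2 * m - 1) + 3 * q ^ m"
proof -
  define r where "r = q ^ m"
  define s where "s = q ^ (m - 1)"
  have r_eq: "r = s * q" using m by (simp add: r_def s_def flip: power_Suc2)
  have s_pos: "s \<ge> 1" and r_pos: "r \<ge> 1" using q_pos by (simp_all add: s_def r_def Suc_leI)
  define S where "S = {x \<in> Fq (2 * m) - {0}. tr (2 * m) (a * x + b / x) = c}"
  define h where "h x = tr m (a * x + b / x)" for x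
  define hp where "hp = (\<Sum>i<m. Polynomial.monom a (s + q ^ i) + Polynomial.monom b (s - q ^ i))"
  have qi_le: "q ^ i \<le> s" if "i < m" for i
    unfolding s_def using that q_pos by (intro power_increasing) auto
  have qi_less: "q ^ i < s" if "i < m - 1" for i
    unfolding s_def using that q_ge_2 by (intro power_strict_increasing) auto
  have deg_hp_le: "Polynomial.degree hp \<le> 2 * s"
    unfolding hp_def
    by (intro degree_sum_le degree_add_le order_trans[OF degree_monom_le]) (use qi_le in fastforce)+
  have "Polynomial.coeff hp (2 * s) = (\<Sum>i<m. if i = m - 1 then a else 0)"
    unfolding hp_def coeff_sum
  proof (rule sum.cong)
    fix i assume i: "i \<in> {..<m}"
    show "Polynomial.coeff (Polynomial.monom a (s + q ^ i) + Polynomial.monom b (s - q ^ i)) (2 * s)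
        = (if i = m - 1 then a else 0)"
    proof (cases "i = m - 1")
      case True
      then show ?thesis using q_pos by (simp add: s_def)
    next
      case False
      then have "q ^ i < s" using i qi_less by auto
      then show ?thesis using False s_pos by auto
    qed
  qed simp
  also have "\<dots> = a" using m by simp
  finally have coeff_hp: "Polynomial.coeff hp (2 * s) = a" .
  have deg_hp: "Polynomial.degree hp = 2 * s"
    using deg_hp_le le_degree[of hp "2 * s"] coeff_hp a by simp
  have hp0: "hp \<noteq> 0" using coeff_hp a by auto
  have frob_ab: "a ^ (q ^ i) = a" "b ^ (q ^ i) = b" for i
    using Fq_mono_1[OF a(1), of i] Fq_mono_1[OF b, of i] by (simp_all add: Fq_def)
  have poly_hp: "poly hp x = x ^ s * h x" if "x \<noteq> 0" for x
  proof -
    have "poly hp x = (\<Sum>i<m. a * x ^ (s + q ^ i) + b * x ^ (s - q ^ i))"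
      by (simp add: hp_def poly_sum poly_monom)
    also have "\<dots> = (\<Sum>i<m. x ^ s * (a * x + b / x) ^ (q ^ i))"
    proof (rule sum.cong)
      fix i assume "i \<in> {..<m}"
      then have "x ^ (s - q ^ i) = x ^ s / x ^ (q ^ i)"
        using qi_le that by (simp add: power_diff)
      then show "a * x ^ (s + q ^ i) + b * x ^ (s - q ^ i) = x ^ s * (a * x + b / x) ^ (q ^ i)"
        by (simp add: frobenius_add power_mult_distrib power_divide frob_ab power_add algebra_simps)
    qed simp
    also have "\<dots> = x ^ s * h x" by (simp add: h_def tr_def sum_distrib_left)
    finally show ?thesis .
  qed
  define N where "N = r * (s + 2)"
  define l where "l n = (n div s) mod q" for n
  have l_less: "l n < q" for n using q_pos by (simp add: l_def)
  define P where "P n = Polynomial.monom 1 (n mod s + r * (n div r) + s * (q - 1 - l n)) * hp ^ l n" for n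
  define R where "R n = Polynomial.monom 1 (r * (n mod s) + n div r + s * (q - 1 - l n))
      * (Polynomial.monom c s - hp) ^ l n" for n
  have split_q: "s * (q - 1 - l n) + s * l n = s * (q - 1)" for n
    using l_less[of n] by (simp flip: distrib_left)
  have P: "P n \<noteq> 0 \<and> Polynomial.degree (P n) = n + s * (q - 1)" for n
  proof -
    have "Polynomial.degree (P n) = n mod s + r * (n div r) + s * (q - 1 - l n) + l n * (2 * s)"
      unfolding P_def using hp0
      by (subst degree_mult_eq) (auto simp: degree_monom_eq degree_power_eq deg_hp monom_eq_0_iff)
    also have "\<dots> = (n mod s + s * l n + r * (n div r)) + s * (q - 1)"
      using split_q[of n] by (simp add: algebra_simps)
    also have "n mod s + s * l n + r * (n div r) = n"
      using mod_mult2_eq[of n s q] mod_mult_div_eq[of n r] by (simp add: l_def r_eq)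
    finally show ?thesis using hp0 by (simp add: P_def monom_eq_0_iff)
  qed
  define E where "E = (s - 1) * r + (s + 2) + 2 * (s * (q - 1))"
  have deg_R: "Polynomial.degree (R n) < E" if "n < N" for n
  proof -
    have "n div r < s + 2" using that by (simp add: N_def less_mult_imp_div_less mult.commute)
    moreover have "r * (n mod s) \<le> (s - 1) * r"
    proof -
      have "n mod s < s" using s_pos by simp
      then have "n mod s \<le> s - 1" by linarith
      then show ?thesis by (simp add: mult.commute)
    qed
    moreover have "Polynomial.degree (R n)
        \<le> (r * (n mod s) + n div r + s * (q - 1 - l n)) + l n * (2 * s)"
    proof -
      have "Polynomial.degree (Polynomial.monom c s - hp) \<le> 2 * s"
        using degree_diff_le[of "Polynomial.monom c s" "2 * s" hp] degree_monom_le[of c s] deg_hp_le by simp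
      then have "Polynomial.degree ((Polynomial.monom c s - hp) ^ l n) \<le> l n * (2 * s)"
        using degree_power_le[of "Polynomial.monom c s - hp" "l n"]
        by (metis (no_types, lifting) le_trans mult.commute mult_le_mono1)
      then show ?thesis
        unfolding R_def by (intro order_trans[OF degree_mult_le] add_mono degree_monom_le)
    qed
    moreover have "l n * (2 * s) = 2 * (s * l n)" by simp
    moreover have "s * l n \<le> s * (q - 1)" using split_q[of n] by linarith
    ultimately show ?thesis using split_q[of n] unfolding E_def by linarith
  qed
  \<comment> \<open>More unknowns than equations; the summand 2 in \<open>s + 2\<close> pays for this.\<close>
  have "N > E"
  proof -
    have "s * (q - 1) = r - s" by (simp add: r_eq algebra_simps)
    moreover have "r \<ge> 2 * s" using q_ge_2 by (simp add: r_eq)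
    moreover have "(s - 1) * r + r = s * r" using s_pos by (metis Suc_diff_1 Suc_le_lessD mult_Suc add.commute One_nat_def)
    moreover have "N = s * r + 2 * r" by (simp add: N_def algebra_simps)
    ultimately show ?thesis unfolding E_def using s_pos by linarith
  qed
  then obtain d where d: "\<exists>n\<in>{..<N}. d n \<noteq> 0"
      "\<forall>j<E. (\<Sum>n\<in>{..<N}. d n * Polynomial.coeff (R n) j) = 0"
    using homogeneous_system_nontrivial_solution[of "{..<N}" E "\<lambda>n. Polynomial.coeff (R n)"] by auto
  have relation: "(\<Sum>n<N. Polynomial.smult (d n) (R n)) = 0"
  proof (rule poly_eqI)
    fix j
    show "Polynomial.coeff (\<Sum>n<N. Polynomial.smult (d n) (R n)) j = Polynomial.coeff 0 j"
    proof (cases "j < E")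
      case True
      then show ?thesis using d(2) by (simp add: coeff_sum)
    next
      case False
      have "Polynomial.coeff (R n) j = 0" if "n < N" for n
        using deg_R[OF that] False by (intro coeff_eq_0) linarith
      then show ?thesis by (simp add: coeff_sum)
    qed
  qed
  have "\<forall>n. \<exists>y. y ^ r = d n" using nth_root_exists[of r] r_pos by auto
  then obtain e where e: "\<And>n. e n ^ r = d n" by metis
  define H where "H = (\<Sum>n<N. Polynomial.smult (e n) (P n))"
  have "\<exists>n<N. e n \<noteq> 0"
  proof -
    obtain n where "n < N" "d n \<noteq> 0" using d(1) by auto
    then show ?thesis using e[of n] r_pos by (intro exI[of _ n]) (auto simp: zero_power)
  qed
  then have H0: "H \<noteq> 0"
    unfolding H_def by (intro poly_combination_nonzero) (use P in auto)
  have deg_H: "Polynomial.degree H \<le> N + s * (q - 1)"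
    unfolding H_def
    by (intro degree_sum_le order_trans[OF degree_smult_le]) (auto simp: P)
  have root: "poly H x = 0" if x: "x \<in> S" for x
  proof -
    have x0: "x \<noteq> 0" and tr_x: "tr (2 * m) (a * x + b / x) = c" and xF: "x \<in> Fq (2 * m)"
      using x by (auto simp: S_def)
    have "h x + h x ^ r = c"
      unfolding h_def r_def by (simp only: tr_double[symmetric] tr_x)
    then have h_r: "h x ^ r = c - h x" by (metis add_diff_cancel_left')
    have x_rr: "(x ^ r) ^ r = x"
      using xF by (simp add: r_def frobenius_iterate Fq_def mult_2)
    define w where "w = x ^ (s * (q - 1))"
    have w0: "w \<noteq> 0" using x0 by (simp add: w_def)
    have w_eq: "x ^ (s * (q - 1 - l n)) * (x ^ s) ^ l n = w" for n
      unfolding w_def using split_q[of n] by (simp flip: power_mult power_add)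
    \<comment> \<open>Up to a factor independent of \<open>n\<close>, the \<open>r\<close>-th power of \<open>P n\<close> is \<open>R n\<close> on the fibre.\<close>
    have PR: "poly (P n) x ^ r = w ^ r / w * poly (R n) x" for n
    proof -
      have "poly (P n) x = x ^ (n mod s) * (x ^ r) ^ (n div r) * (x ^ (s * (q - 1 - l n)) * (x ^ s) ^ l n) * h x ^ l n"
        by (simp add: P_def poly_monom poly_hp[OF x0] power_add power_mult power_mult_distrib mult_ac)
      then have "poly (P n) x = x ^ (n mod s) * (x ^ r) ^ (n div r) * w * h x ^ l n"
        by (simp only: w_eq)
      then have "poly (P n) x ^ r
          = (x ^ r) ^ (n mod s) * ((x ^ r) ^ r) ^ (n div r) * w ^ r * (h x ^ r) ^ l n"
        by (simp add: power_mult_distrib flip: power_mult) (simp add: mult_ac)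
      then have L: "poly (P n) x ^ r = (x ^ r) ^ (n mod s) * x ^ (n div r) * w ^ r * (c - h x) ^ l n"
        by (simp only: x_rr h_r)
      have "poly (R n) x = (x ^ r) ^ (n mod s) * x ^ (n div r) * x ^ (s * (q - 1 - l n)) * (c * x ^ s - x ^ s * h x) ^ l n"
        by (simp add: R_def poly_monom poly_hp[OF x0] power_add power_mult)
      also have "c * x ^ s - x ^ s * h x = x ^ s * (c - h x)" by (simp add: algebra_simps)
      also have "(x ^ r) ^ (n mod s) * x ^ (n div r) * x ^ (s * (q - 1 - l n)) * (x ^ s * (c - h x)) ^ l n
          = (x ^ r) ^ (n mod s) * x ^ (n div r) * (x ^ (s * (q - 1 - l n)) * (x ^ s) ^ l n) * (c - h x) ^ l n"
        by (simp add: power_mult_distrib mult_ac)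
      finally have "poly (R n) x = (x ^ r) ^ (n mod s) * x ^ (n div r) * w * (c - h x) ^ l n"
        by (simp only: w_eq)
      then show ?thesis using L w0 by simp
    qed
    have "poly H x ^ r = (\<Sum>n<N. (e n * poly (P n) x) ^ r)"
      by (simp add: H_def poly_sum r_def frobenius_sum)
    also have "\<dots> = (\<Sum>n<N. w ^ r / w * (d n * poly (R n) x))"
      by (intro sum.cong) (simp_all add: power_mult_distrib e PR)
    also have "\<dots> = w ^ r / w * poly (\<Sum>n<N. Polynomial.smult (d n) (R n)) x"
      by (simp add: poly_sum sum_distrib_left)
    also have "\<dots> = 0" by (simp add: relation)
    finally show ?thesis using r_pos by simp
  qed
  have "card S \<le> card {x. poly H x = 0}"
    using root poly_roots_finite[OF H0] by (intro card_mono) auto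
  also have "\<dots> \<le> Polynomial.degree H" by (rule card_poly_roots_bound[OF H0])
  also have "\<dots> \<le> N + s * (q - 1)" by (rule deg_H)
  also have "\<dots> \<le> r * s + 3 * r"
    using r_eq by (simp add: N_def algebra_simps)
  also have "r * s = q ^ (2 * m - 1)"
    using m by (simp add: r_def s_def mult_2 flip: power_add)
  finally show ?thesis by (simp add: S_def r_def)
qed

text \<open>
  The sum is the character sum of the fibre sizes \<open>N c\<close>. Stepanov's method only bounds these from above, but they
  add up to \<open>q^(2m) - 1\<close>, so the total deficit from the common upper bound \<open>U\<close> is small as well; and \<open>U\<close>
  may be subtracted from every \<open>N c\<close> because a nontrivial character sums to zero.
\<close>
lemma norm_kloosterman_even_le:
  assumes m: "m \<ge> 1" and a: "a \<in> Fq 1" "a \<noteq> 0" and b: "b \<in> Fq 1"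
  shows "norm (kloosterman (2 * m) a b) \<le> 4 * real q * real q ^ m"
proof -
  define G where "G = Fq (2 * m) - {0}"
  define T where "T x = tr (2 * m) (a * x + b / x)" for x
  define N where "N c = card {x \<in> G. T x = c}" for c
  define U where "U = real q ^ (2 * m - 1) + 3 * real q ^ m"
  have fin: "finite G" "finite (Fq 1)" using card_Fq(1)[of "2 * m"] card_Fq(1)[of 1] m by (simp_all add: G_def)
  have TG: "T ` G \<subseteq> Fq 1"
    unfolding T_def G_def using Fq_mono_1 a b Fq_closed by (intro image_subsetI tr_in_Fq_1) auto
  have N_le: "real (N c) \<le> U" if "c \<in> Fq 1" for c
  proof -
    have "N c \<le> q ^ (2 * m - 1) + 3 * q ^ m"
      unfolding N_def G_def T_def by (rule card_trace_fibre_le) (use m a b that in auto)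
    then have "real (N c) \<le> real (q ^ (2 * m - 1) + 3 * q ^ m)" by (rule of_nat_mono)
    then show ?thesis by (simp add: U_def)
  qed
  have sum_psi: "(\<Sum>c\<in>Fq 1. psi c) = 0"
  proof -
    obtain z where "z ^ q = z" "psi z \<noteq> 1" using psi_nontrivial by blast
    then show ?thesis
      using psi_sum_eq_0[of z 1 1] Fq_closed(2)[of 1] by (simp add: tr_def Fq_def)
  qed
  have "kloosterman (2 * m) a b = (\<Sum>c\<in>Fq 1. \<Sum>x | x \<in> G \<and> T x = c. psi (T x))"
    unfolding kloosterman_def G_def[symmetric] T_def[symmetric]
    by (rule sum.group[symmetric, OF fin TG])
  also have "\<dots> = (\<Sum>c\<in>Fq 1. of_nat (N c) * psi c)"
    by (intro sum.cong refl) (simp add: N_def)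
  also have "\<dots> = (\<Sum>c\<in>Fq 1. of_nat (N c) * psi c) - of_real U * (\<Sum>c\<in>Fq 1. psi c)"
    by (simp only: sum_psi, simp)
  also have "\<dots> = (\<Sum>c\<in>Fq 1. of_real (real (N c) - U) * psi c)"
    by (simp add: sum_distrib_left sum_subtractf left_diff_distrib)
  also have "norm \<dots> \<le> (\<Sum>c\<in>Fq 1. norm (of_real (real (N c) - U) * psi c))"
    by (rule norm_sum)
  also have "\<dots> = (\<Sum>c\<in>Fq 1. U - real (N c))"
  proof (rule sum.cong)
    fix c assume c: "c \<in> Fq 1"
    then show "norm (of_real (real (N c) - U) * psi c) = U - real (N c)"
      using N_le[OF c] norm_psi[of c] by (simp add: norm_mult Fq_def flip: of_real_diff)
  qed simp
  also have "\<dots> = real q * U - real (\<Sum>c\<in>Fq 1. N c)"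
    using card_Fq[of 1] by (simp add: sum_subtractf)
  also have "(\<Sum>c\<in>Fq 1. N c) = card G"
    using sum.group[OF fin TG, of "\<lambda>_. 1 :: nat"] by (simp add: N_def)
  also have "card G = q ^ (2 * m) - 1"
    using card_Fq[of "2 * m"] m Fq_closed(1)[of "2 * m"] by (simp add: G_def)
  also have "real (q ^ (2 * m) - 1) = real q * real q ^ (2 * m - 1) - 1"
    using m q_pow_pos[of "2 * m"] by (simp add: of_nat_diff flip: power_Suc)
  also have "real q * U - (real q * real q ^ (2 * m - 1) - 1) = 3 * real q * real q ^ m + 1"
    by (simp add: U_def algebra_simps)
  also have "\<dots> \<le> 4 * real q * real q ^ m"
  proof -
    have "real (q * q ^ m) \<ge> real 1" using q_pos by (intro of_nat_mono) (simp add: Suc_leI)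
    then show ?thesis by simp
  qed
  finally show ?thesis .
qed

text \<open>
  The normalised sums \<open>y j\<close> satisfy \<open>y (j + 1) \<ge> (y j)^2 - 2\<close>. A starting value \<open>2 + \<delta>\<close> would thus grow at least like
  \<open>2 + 4^j \<delta>\<close>, while the preceding lemma keeps them bounded.
\<close>
theorem norm_kloosterman_le:
  assumes a: "a \<in> Fq 1" "a \<noteq> 0" and b: "b \<in> Fq 1" "b \<noteq> 0"
  shows "norm (kloosterman 1 a b) \<le> 2 * sqrt (real q)"
proof (rule ccontr)
  assume contr: "\<not> ?thesis"
  define y where "y j = norm (kloosterman (2 ^ j) a b) / sqrt (real q) ^ (2 ^ j)" for j :: nat
  have q: "real q > 0" using q_pos by simp
  have sqrt_pow: "sqrt (real q) ^ (2 ^ Suc j) = real q ^ (2 ^ j)" for j :: nat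
    using q by (simp add: power_mult)
  have step: "y (Suc j) \<ge> (y j)\<^sup>2 - 2" for j
  proof -
    obtain z where z: "z \<in> Fq (2 ^ j)" "psi (tr (2 ^ j) z) \<noteq> 1"
      using psi_tr_nontrivial by blast
    have "kloosterman (2 ^ Suc j) a b = 2 * of_nat (q ^ 2 ^ j) - (kloosterman (2 ^ j) a b)\<^sup>2"
      unfolding power_Suc using z a b Fq_mono_1 by (intro kloosterman_double) auto
    then have "norm (kloosterman (2 ^ Suc j) a b)
        \<ge> norm ((kloosterman (2 ^ j) a b)\<^sup>2) - norm (2 * of_nat (q ^ 2 ^ j) :: complex)"
      by (metis norm_minus_commute norm_triangle_ineq2)
    then have "norm (kloosterman (2 ^ Suc j) a b) \<ge> (norm (kloosterman (2 ^ j) a b))\<^sup>2 - 2 * real q ^ 2 ^ j"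
      by (simp add: norm_mult norm_power)
    then have "y (Suc j) \<ge> ((norm (kloosterman (2 ^ j) a b))\<^sup>2 - 2 * real q ^ 2 ^ j) / real q ^ 2 ^ j"
      unfolding y_def sqrt_pow using q by (intro divide_right_mono) auto
    also have "((norm (kloosterman (2 ^ j) a b))\<^sup>2 - 2 * real q ^ 2 ^ j) / real q ^ 2 ^ j = (y j)\<^sup>2 - 2"
    proof -
      have "(sqrt (real q) ^ 2 ^ j)\<^sup>2 = real q ^ 2 ^ j"
        using sqrt_pow[of j] by (simp add: power_mult[symmetric] mult.commute)
      then show ?thesis using q by (simp add: y_def power_divide diff_divide_distrib)
    qed
    finally show ?thesis .
  qed
  have bounded: "y (Suc j) \<le> 4 * real q" for j
  proof -
    have "norm (kloosterman (2 ^ Suc j) a b) \<le> 4 * real q * real q ^ 2 ^ j"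
      unfolding power_Suc using a b by (intro norm_kloosterman_even_le) auto
    then show ?thesis unfolding y_def sqrt_pow using q by (simp add: field_simps)
  qed
  define \<delta> where "\<delta> = y 0 - 2"
  have \<delta>: "\<delta> > 0" using contr q by (simp add: \<delta>_def y_def field_simps)
  have grow: "y j \<ge> 2 + 4 ^ j * \<delta>" for j
  proof (induction j)
    case (Suc j)
    have "(y j)\<^sup>2 \<ge> (2 + 4 ^ j * \<delta>)\<^sup>2" using Suc \<delta> by (intro power_mono) auto
    also have "(2 + 4 ^ j * \<delta>)\<^sup>2 = 4 + 4 * (4 ^ j * \<delta>) + (4 ^ j * \<delta>)\<^sup>2"
      by (simp add: power2_eq_square algebra_simps)
    finally show ?case
      using step[of j] zero_le_power2[of "4 ^ j * \<delta>"] power_Suc[of "4 :: real" j]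
      by (simp only: mult.assoc)
  qed (simp add: \<delta>_def)
  obtain j where "4 * real q / \<delta> < 4 ^ j" using real_arch_pow[of 4] by auto
  then have "4 * real q < 4 ^ j * \<delta>" using \<delta> by (simp add: field_simps)
  also have "\<dots> \<le> 4 ^ Suc j * \<delta>" using \<delta> by simp
  finally show False using grow[of "Suc j"] bounded[of j] by linarith
qed

end

section \<open>Weil's bound over a finite field\<close>

lemma finite_field_power_card:
  fixes x :: "'a::{field,finite}"
  shows "x ^ CARD('a) = x"
proof (cases "x = 0")
  case False
  have "(\<Prod>y\<in>UNIV-{0}. x * y) = (\<Prod>y\<in>UNIV-{0}. y)"
    by (rule prod.reindex_bij_witness[of _ "\<lambda>y. y / x" "\<lambda>y. x * y"]) (use False in auto)
  then have "x ^ (CARD('a) - 1) = 1"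
    by (simp add: prod.distrib)
  moreover have "x ^ CARD('a) = x * x ^ (CARD('a) - 1)" by (simp add: power_eq_if)
  ultimately show ?thesis by simp
qed simp

lemma of_nat_card_eq_0: "of_nat CARD('a) = (0 :: 'a::{field,finite})"
proof -
  have "(\<Sum>x\<in>UNIV. x :: 'a) = (\<Sum>x\<in>UNIV. x + 1)"
    by (rule sum.reindex_bij_witness[of _ "\<lambda>x. x + 1" "\<lambda>x. x - 1"]) auto
  then show ?thesis by (simp add: sum.distrib)
qed

lemma prime_CHAR_finite_field: "Factorial_Ring.prime CHAR('a::{field,finite})"
  using prime_CHAR_semidom[where 'a = 'a] finite_imp_CHAR_pos[where 'a = 'a] by simp

lemma two_neq_0_odd_card:
  assumes "odd CARD('a::{field,finite})"
  shows "(2 :: 'a) \<noteq> 0"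
proof
  assume "(2 :: 'a) = 0"
  then have "of_nat 2 = (0 :: 'a)" by simp
  then have "CHAR('a) dvd 2" by (simp only: of_nat_eq_0_iff_char_dvd)
  then have "CHAR('a) = 2" using prime_CHAR_finite_field[where 'a = 'a]
    by (intro primes_dvd_imp_eq two_is_prime_nat)
  then show False
    using of_nat_card_eq_0[where 'a = 'a] assms by (simp add: of_nat_eq_0_iff_char_dvd)
qed

text \<open>
  The polynomial \<open>(1 + X)^q - X^q - 1\<close> has degree below \<open>q\<close> and vanishes on the whole field, hence is zero. This gives
  additivity of the \<open>q\<close>-th power map in every extension.
\<close>
lemma choose_card_finite_field_eq_0:
  assumes "0 < k" "k < CARD('a)"
  shows "of_nat (CARD('a) choose k) = (0 :: 'a::{field,finite})"
proof -
  define q where "q = CARD('a)"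
  define P :: "'a poly" where "P = [:1, 1:] ^ q - Polynomial.monom 1 q - 1"
  have q: "q > 0" by (simp add: q_def)
  have coeff: "Polynomial.coeff P j = of_nat (q choose j)" if "0 < j" "j < q" for j
    using that by (simp add: P_def coeff_linear_poly_power)
  have "Polynomial.degree P < q"
  proof (rule degree_lessI)
    show "\<forall>j\<ge>q. Polynomial.coeff P j = 0"
    proof (intro allI impI)
      fix j assume "j \<ge> q"
      moreover have "Polynomial.coeff ([:1, 1:] ^ q :: 'a poly) j = 0" if "j > q"
        using that by (intro coeff_eq_0) (simp add: degree_linear_power)
      ultimately show "Polynomial.coeff P j = 0"
        using q by (cases "j = q") (auto simp: P_def coeff_linear_poly_power)
    qed
  qed (use q in auto)
  have "poly P x = 0" for x
    using finite_field_power_card[of x] finite_field_power_card[of "1 + x"]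
    by (simp add: P_def poly_monom q_def)
  then have "P = 0"
    using card_poly_roots_bound[of P] \<open>Polynomial.degree P < q\<close> by (auto simp: q_def)
  then show ?thesis using coeff[of k] assms by (simp add: q_def)
qed

lemma frobenius_alg_closure:
  fixes x y :: "'a::{field,finite} alg_closure"
  shows "(x + y) ^ CARD('a) = x ^ CARD('a) + y ^ CARD('a)"
proof -
  define q where "q = CARD('a)"
  have q: "q > 0" by (simp add: q_def)
  have zero: "of_nat (q choose k) = (0 :: 'a alg_closure)" if "0 < k" "k < q" for k
    using choose_card_finite_field_eq_0[of k, where 'a = 'a] that
    by (metis q_def to_ac_0 to_ac_of_nat)
  have "(x + y) ^ q = (\<Sum>k\<le>q. of_nat (q choose k) * x ^ k * y ^ (q - k))"
    by (rule binomial_ring)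
  also have "\<dots> = (\<Sum>k\<in>{0, q}. of_nat (q choose k) * x ^ k * y ^ (q - k))"
  proof (rule sum.mono_neutral_right)
    show "\<forall>k\<in>{..q} - {0, q}. of_nat (q choose k) * x ^ k * y ^ (q - k) = 0"
    proof
      fix k assume "k \<in> {..q} - {0, q}"
      then have "0 < k" "k < q" by auto
      then show "of_nat (q choose k) * x ^ k * y ^ (q - k) = 0" by (simp add: zero)
    qed
  qed auto
  also have "\<dots> = x ^ q + y ^ q" using q by simp
  finally show ?thesis by (simp add: q_def)
qed

lemma range_to_ac_eq: "range (to_ac :: 'a::{field,finite} \<Rightarrow> _) = {x. x ^ CARD('a) = x}"
proof (rule card_seteq)
  define q where "q = CARD('a)"
  have "card {0, 1 :: 'a} \<le> q" unfolding q_def by (intro card_mono) auto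
  then have q: "q \<ge> 2" by simp
  define P :: "'a alg_closure poly" where "P = Polynomial.monom 1 q - [:0, 1:]"
  have deg: "Polynomial.degree P = q"
    unfolding P_def using q
    by (subst diff_conv_add_uminus, subst degree_add_eq_left) (auto simp: degree_monom_eq)
  then have P0: "P \<noteq> 0" using q by auto
  have roots: "{x. poly P x = 0} = {x. x ^ CARD('a) = x}" by (simp add: P_def poly_monom q_def)
  show "finite {x :: 'a alg_closure. x ^ CARD('a) = x}"
    using poly_roots_finite[OF P0] by (simp add: roots)
  show "range (to_ac :: 'a \<Rightarrow> _) \<subseteq> {x. x ^ CARD('a) = x}"
    by (auto simp: finite_field_power_card simp flip: to_ac_power)
  show "card {x :: 'a alg_closure. x ^ CARD('a) = x} \<le> card (range (to_ac :: 'a \<Rightarrow> _))"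
    using card_poly_roots_bound[OF P0] deg by (simp add: roots q_def card_image inj_to_ac)
qed

definition additive_character :: "('a::{field,finite} \<Rightarrow> complex) \<Rightarrow> bool" where
  "additive_character \<psi> \<longleftrightarrow>
     (\<forall>x y. \<psi> (x + y) = \<psi> x * \<psi> y) \<and> (\<forall>x. norm (\<psi> x) = 1) \<and> (\<exists>z. \<psi> z \<noteq> 1)"

text \<open>
  The embedding into the algebraic closure identifies the field with \<open>Fq 1\<close>, and the sum with \<open>kloosterman 1\<close>.
\<close>
theorem kloosterman_sum_le:
  fixes \<psi> :: "'a::{field,finite} \<Rightarrow> complex"
  assumes "odd CARD('a)" "additive_character \<psi>" "a \<noteq> 0" "b \<noteq> 0"
  shows "norm (\<Sum>x\<in>-{0}. \<psi> (a * x + b / x)) \<le> 2 * sqrt (real CARD('a))"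
proof -
  define psi where "psi = (\<lambda>x. \<psi> (of_ac x))"
  have psi: "psi (to_ac x) = \<psi> x" for x by (simp add: psi_def)
  have fixed: "\<exists>x'. x = to_ac x'" if "x ^ CARD('a) = x" for x :: "'a alg_closure"
    using that range_to_ac_eq[where 'a = 'a] by auto
  interpret frobenius_character "CARD('a)" psi
  proof
    have "card {0, 1 :: 'a} \<le> CARD('a)" by (intro card_mono) auto
    then show "CARD('a) \<ge> 2" by simp
    show "of_nat CARD('a) = (0 :: 'a alg_closure)"
      by (metis of_nat_card_eq_0 to_ac_0 to_ac_of_nat)
    show "(2 :: 'a alg_closure) \<noteq> 0"
      using two_neq_0_odd_card[OF assms(1)] by (metis to_ac_eq_0_iff to_ac_numeral)
    show "(x + y) ^ CARD('a) = x ^ CARD('a) + y ^ CARD('a)" for x y :: "'a alg_closure"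
      by (rule frobenius_alg_closure)
    show "psi (x + y) = psi x * psi y" if xy: "x ^ CARD('a) = x" "y ^ CARD('a) = y" for x y
    proof -
      obtain x' y' where "x = to_ac x'" "y = to_ac y'" using fixed xy by meson
      then show ?thesis using assms(2) by (simp add: psi additive_character_def flip: to_ac_add)
    qed
    show "norm (psi x) = 1" if "x ^ CARD('a) = x" for x
      using fixed[OF that] assms(2) by (auto simp: psi additive_character_def)
    obtain z where "\<psi> z \<noteq> 1" using assms(2) by (auto simp: additive_character_def)
    then show "\<exists>z. z ^ CARD('a) = z \<and> psi z \<noteq> 1"
      using range_to_ac_eq[where 'a = 'a] by (intro exI[of _ "to_ac z"]) (auto simp: psi)
  qed
  have Fq_1: "Fq 1 = range to_ac" by (simp add: Fq_def range_to_ac_eq)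
  have "kloosterman 1 (to_ac a) (to_ac b) = (\<Sum>x\<in>-{0}. \<psi> (a * x + b / x))"
    unfolding kloosterman_def Fq_1
  proof (rule sum.reindex_bij_witness[of _ to_ac of_ac])
    fix x assume "x \<in> range to_ac - {0 :: 'a alg_closure}"
    then obtain x' where "x = to_ac x'" "x' \<noteq> 0" by auto
    then show "\<psi> (a * of_ac x + b / of_ac x) = psi (tr 1 (to_ac a * x + to_ac b / x))"
      by (simp add: tr_def psi flip: to_ac_mult to_ac_divide to_ac_add)
  qed auto
  moreover have "norm (kloosterman 1 (to_ac a) (to_ac b)) \<le> 2 * sqrt (real CARD('a))"
    by (rule norm_kloosterman_le) (use assms Fq_1 in auto)
  ultimately show ?thesis by simp
qed

section \<open>Existence of a nontrivial additive character\<close>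

lemma finite_field_of_nat_inverse:
  assumes "\<not> CHAR('a::{field,finite}) dvd d"
  shows "\<exists>j. of_nat j * of_nat d = (1 :: 'a)"
proof -
  define p where "p = CHAR('a)"
  have "Factorial_Ring.prime p" using prime_CHAR_finite_field by (simp add: p_def)
  then have "coprime d p" using assms by (metis p_def prime_imp_coprime coprime_commute)
  then obtain j where "[d * j = 1] (mod p)" using cong_solve_coprime_nat by auto
  then have "of_nat (d * j) = (of_nat 1 :: 'a)"
    by (simp only: of_nat_eq_iff_cong_CHAR p_def)
  then show ?thesis by (intro exI[of _ j]) (simp add: mult.commute)
qed

text \<open>
  Let \<open>M\<close> be maximal among the additive subgroups that do not contain \<open>1\<close>. Adjoining any \<open>x\<close> outside \<open>M\<close>
  captures \<open>1\<close>, so \<open>x\<close> is congruent modulo \<open>M\<close> to a multiple \<open>\<nu> x\<close> of \<open>1\<close>, unique modulo the characteristic \<open>p\<close>.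
  Thus \<open>M\<close> is a hyperplane over the prime field, and \<open>x\<close> is sent to \<open>exp (2 \<pi> i \<nu> x / p)\<close>.
\<close>
theorem additive_character_exists: "\<exists>\<psi> :: 'a::{field,finite} \<Rightarrow> complex. additive_character \<psi>"
proof -
  define p where "p = CHAR('a)"
  have p: "Factorial_Ring.prime p" using prime_CHAR_finite_field by (simp add: p_def)
  have "of_nat (p - 1) = (of_nat p - 1 :: 'a)" using prime_gt_0_nat[OF p] by (simp add: of_nat_diff)
  then have of_nat_p: "of_nat (p - 1) = (- 1 :: 'a)" by (simp add: p_def)
  define avoiding where
    "avoiding = {M :: 'a set. 0 \<in> M \<and> (\<forall>x\<in>M. \<forall>y\<in>M. x - y \<in> M) \<and> 1 \<notin> M}"
  have "{0} \<in> avoiding" by (auto simp: avoiding_def)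
  then obtain M where M: "M \<in> avoiding" and maximal: "\<And>M'. M' \<in> avoiding \<Longrightarrow> M \<subseteq> M' \<Longrightarrow> M = M'"
    using finite_has_maximal[of avoiding] by (metis empty_iff finite)
  have M0: "0 \<in> M" and diff: "\<And>x y. x \<in> M \<Longrightarrow> y \<in> M \<Longrightarrow> x - y \<in> M" and M1: "1 \<notin> M"
    using M by (auto simp: avoiding_def)
  have minus: "- x \<in> M" if "x \<in> M" for x using diff[OF M0 that] by simp
  have add: "x + y \<in> M" if "x \<in> M" "y \<in> M" for x y using diff[OF that(1) minus[OF that(2)]] by simp
  have mult: "of_nat n * x \<in> M" if "x \<in> M" for n x
    by (induction n) (auto simp: M0 distrib_right intro: add that)
  have not_dvd: "\<not> of_nat n \<in> M" if nd: "\<not> p dvd n" for n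
  proof
    assume "of_nat n \<in> M"
    moreover obtain j where "of_nat j * of_nat n = (1 :: 'a)"
      using finite_field_of_nat_inverse[of n, where 'a = 'a] nd unfolding p_def by blast
    ultimately show False using mult[of "of_nat n" j] M1 by simp
  qed
  have "\<exists>n. x - of_nat n \<in> M" for x
  proof (cases "x \<in> M")
    case True
    then show ?thesis by (intro exI[of _ 0]) simp
  next
    case False
    define M' where "M' = {m + of_nat k * x | m k. m \<in> M}"
    have sub: "M \<subseteq> M'"
    proof
      fix m assume "m \<in> M"
      then have "m + of_nat 0 * x \<in> M'" unfolding M'_def by blast
      then show "m \<in> M'" by simp
    qed
    have "x \<in> M'"
    proof -
      have "0 + of_nat 1 * x \<in> M'" unfolding M'_def using M0 by blast
      then show ?thesis by simp
    qed
    have "u - v \<in> M'" if uv: "u \<in> M'" "v \<in> M'" for u v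
    proof -
      obtain m k m' k' where u: "u = m + of_nat k * x" "m \<in> M" and v: "v = m' + of_nat k' * x" "m' \<in> M"
        using uv by (auto simp: M'_def)
      have "of_nat (k + (p - 1) * k') = of_nat k - (of_nat k' :: 'a)"
        by (simp only: of_nat_add of_nat_mult of_nat_p) simp
      then have "u - v = (m - m') + of_nat (k + (p - 1) * k') * x"
        by (simp only: u v) (simp add: algebra_simps)
      then show ?thesis unfolding M'_def using diff u v by blast
    qed
    then have "M' \<in> avoiding \<or> 1 \<in> M'" using sub M0 by (auto simp: avoiding_def)
    then have "1 \<in> M'" using maximal sub \<open>x \<in> M'\<close> False by auto
    then obtain m k where mk: "1 = m + of_nat k * x" "m \<in> M" by (auto simp: M'_def)
    have "\<not> p dvd k"
    proof
      assume "p dvd k"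
      then have "of_nat k = (0 :: 'a)" by (simp add: of_nat_eq_0_iff_char_dvd p_def)
      then show False using mk M1 by simp
    qed
    then obtain j where j: "of_nat j * of_nat k = (1 :: 'a)"
      using finite_field_of_nat_inverse[of k, where 'a = 'a] unfolding p_def by blast
    have "x - of_nat j = x - of_nat j * (m + of_nat k * x)" using mk(1) by simp
    also have "\<dots> = x - of_nat j * of_nat k * x - of_nat j * m" by (simp add: algebra_simps)
    also have "\<dots> = - (of_nat j * m)" by (simp add: j)
    finally have "x - of_nat j \<in> M" using minus[OF mult[OF mk(2), of j]] by (simp only:)
    then show ?thesis ..
  qed
  then obtain \<nu> where \<nu>: "\<And>x. x - of_nat (\<nu> x) \<in> M" by metis
  have unique: "[m = n] (mod p)" if "of_nat m - of_nat n \<in> M" for m n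
  proof -
    have "of_nat (m + (p - 1) * n) = of_nat m - (of_nat n :: 'a)"
      by (simp only: of_nat_add of_nat_mult of_nat_p) simp
    then have "p dvd m + (p - 1) * n" using not_dvd that by metis
    then have "[m + (p - 1) * n + n = 0 + n] (mod p)"
      by (intro cong_add) (simp_all add: cong_0_iff)
    moreover have "m + (p - 1) * n + n = m + p * n"
      using prime_gt_0_nat[OF p] by (cases p) simp_all
    ultimately have "[m + p * n = n] (mod p)" by (simp only: add_0_left)
    then show ?thesis by (simp add: cong_def)
  qed
  define e where "e n = cis (2 * pi * real n / real p)" for n
  have e_add: "e (m + n) = e m * e n" for m n
    by (simp add: e_def cis_mult add_divide_distrib distrib_left)
  have e_p: "e (p * k) = 1" for k
  proof -
    have angle: "2 * pi * real (p * k) / real p = 2 * pi * real k"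
      using prime_gt_0_nat[OF p] by simp
    show ?thesis unfolding e_def angle by (simp only: cis_multiple_2pi Ints_of_nat)
  qed
  have e_mod: "e (n mod p) = e n" for n
    using e_add[of "n mod p" "p * (n div p)"] e_p by simp
  have e_cong: "e m = e n" if "[m = n] (mod p)" for m n
    using that e_mod[of m] e_mod[of n] by (simp add: cong_def)
  define \<psi> where "\<psi> x = e (\<nu> x)" for x :: 'a
  have "\<psi> (x + y) = \<psi> x * \<psi> y" for x y
  proof -
    have "(x - of_nat (\<nu> x)) + (y - of_nat (\<nu> y)) - (x + y - of_nat (\<nu> (x + y))) \<in> M"
      by (intro diff add \<nu>)
    also have "(x - of_nat (\<nu> x)) + (y - of_nat (\<nu> y)) - (x + y - of_nat (\<nu> (x + y)))
        = of_nat (\<nu> (x + y)) - of_nat (\<nu> x + \<nu> y)" by simp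
    finally have "[\<nu> (x + y) = \<nu> x + \<nu> y] (mod p)" by (rule unique)
    then show ?thesis unfolding \<psi>_def e_add[symmetric] by (rule e_cong)
  qed
  moreover have "norm (\<psi> x) = 1" for x by (simp add: \<psi>_def e_def)
  moreover have "\<psi> 1 \<noteq> 1"
  proof
    assume "\<psi> 1 = 1"
    have "of_nat 1 - of_nat (\<nu> 1) \<in> M" using \<nu>[of 1] by simp
    then have "[1 = \<nu> 1] (mod p)" by (rule unique)
    then have "e 1 = 1" using e_cong \<open>\<psi> 1 = 1\<close> by (simp add: \<psi>_def)
    then have "exp (\<i> * complex_of_real (2 * pi / real p)) = 1" by (simp add: e_def cis_conv_exp)
    then obtain k :: int where "2 * pi / real p = of_int (2 * k) * pi"
      unfolding exp_eq_1 by auto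
    then have "of_int k * real p = 1" using prime_gt_0_nat[OF p] by (simp add: field_simps)
    then have "k * int p = 1" by (metis of_int_eq_1_iff of_int_mult of_int_of_nat_eq)
    then show False using prime_gt_1_nat[OF p] by (simp add: zmult_eq_1_iff)
  qed
  ultimately show ?thesis unfolding additive_character_def by blast
qed

section \<open>Gauss sums and Salie sums\<close>

locale odd_field_character =
  fixes \<psi> :: "'a::{field,finite} \<Rightarrow> complex"
  assumes odd_card: "odd CARD('a)" and additive_character: "additive_character \<psi>"
begin

lemma psi_add: "\<psi> (x + y) = \<psi> x * \<psi> y" and norm_psi [simp]: "norm (\<psi> x) = 1"
  using additive_character by (auto simp: additive_character_def)

lemma psi_0 [simp]: "\<psi> 0 = 1"
proof -
  have "\<psi> 0 \<noteq> 0" by (metis norm_psi norm_zero zero_neq_one)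
  then show ?thesis using psi_add[of 0 0] by simp
qed

lemma psi_minus: "\<psi> (- x) = cnj (\<psi> x)"
proof -
  have "\<psi> x * \<psi> (- x) = 1" using psi_add[of x "- x"] by simp
  moreover have "\<psi> x * cnj (\<psi> x) = 1" using norm_psi[of x] by (simp add: complex_norm_square[symmetric])
  ultimately show ?thesis by (metis mult_cancel_left zero_neq_one mult_zero_left)
qed

lemma psi_diff: "\<psi> (x - y) = \<psi> x * cnj (\<psi> y)"
  using psi_add[of x "- y"] by (simp add: psi_minus)

lemma two_neq_0: "(2 :: 'a) \<noteq> 0"
  using two_neq_0_odd_card[OF odd_card] .

lemma four_neq_0: "(4 :: 'a) \<noteq> 0"
proof -
  have "(4 :: 'a) = 2 * 2" by simp
  then show ?thesis using two_neq_0 by (metis mult_eq_0_iff)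
qed

lemma card_ge_2: "CARD('a) \<ge> 2"
proof -
  have "card {0, 1 :: 'a} \<le> CARD('a)" by (intro card_mono) auto
  then show ?thesis by simp
qed

lemma sum_psi_additive_map:
  fixes f :: "'v::{ab_group_add,finite} \<Rightarrow> 'a"
  assumes "\<And>x y. f (x + y) = f x + f y" "\<psi> (f z) \<noteq> 1"
  shows "(\<Sum>x\<in>UNIV. \<psi> (f x)) = 0"
proof -
  have "(\<Sum>x\<in>UNIV. \<psi> (f x)) = (\<Sum>x\<in>UNIV. \<psi> (f (x + z)))"
    by (rule sum.reindex_bij_witness[of _ "\<lambda>x. x + z" "\<lambda>x. x - z"]) auto
  also have "\<dots> = (\<Sum>x\<in>UNIV. \<psi> (f x)) * \<psi> (f z)"
    by (simp add: assms(1) psi_add sum_distrib_right)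
  finally show ?thesis using assms(2) by simp
qed

lemma sum_psi_mult: "(\<Sum>x\<in>UNIV. \<psi> (c * x)) = (if c = 0 then of_nat CARD('a) else 0)"
proof (cases "c = 0")
  case False
  obtain z where "\<psi> z \<noteq> 1" using additive_character by (auto simp: additive_character_def)
  then show ?thesis
    using False by (simp add: sum_psi_additive_map[of _ "z / c"] distrib_left)
qed simp

lemma psi_mult_nontrivial:
  assumes "c \<noteq> 0" shows "\<exists>x. \<psi> (c * x) \<noteq> 1"
proof (rule ccontr)
  assume "\<nexists>x. \<psi> (c * x) \<noteq> 1"
  then have "(\<Sum>x\<in>UNIV. \<psi> (c * x)) = of_nat CARD('a)" by simp
  then show False using sum_psi_mult[of c] assms by simp
qed

text \<open>
  Euler's criterion serves as the definition, so that multiplicativity is immediate; the connection with squares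
  is \<open>eta_eq_1_imp_square\<close>.
\<close>
definition quadratic_character :: "'a \<Rightarrow> complex" where
  "quadratic_character s = (if s = 0 then 0 else if s ^ ((CARD('a) - 1) div 2) = 1 then 1 else - 1)"

abbreviation "\<eta> \<equiv> quadratic_character"

lemma power_half_card:
  fixes s :: 'a
  assumes "s \<noteq> 0" shows "s ^ ((CARD('a) - 1) div 2) = 1 \<or> s ^ ((CARD('a) - 1) div 2) = - 1"
proof -
  have "s ^ CARD('a) = s * s ^ (CARD('a) - 1)" by (simp add: power_eq_if)
  then have "s ^ (CARD('a) - 1) = 1" using finite_field_power_card[of s] assms by simp
  moreover have "CARD('a) - 1 = (CARD('a) - 1) div 2 * 2" using odd_card by simp
  ultimately have "(s ^ ((CARD('a) - 1) div 2))\<^sup>2 = 1" by (metis power_mult)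
  then show ?thesis by (simp add: power2_eq_1_iff)
qed

lemma one_neq_minus_one: "(1 :: 'a) \<noteq> - 1"
  using two_neq_0 by (metis add.right_inverse one_add_one)

lemma eta_mult: "\<eta> (x * y) = \<eta> x * \<eta> y"
proof (cases "x = 0 \<or> y = 0")
  case False
  then have "x \<noteq> 0" "y \<noteq> 0" by auto
  then show ?thesis
    using power_half_card[OF \<open>x \<noteq> 0\<close>] power_half_card[OF \<open>y \<noteq> 0\<close>] one_neq_minus_one
    by (elim disjE)
       (simp_all add: quadratic_character_def power_mult_distrib one_neq_minus_one[symmetric])
qed (auto simp: quadratic_character_def)

lemma eta_0 [simp]: "\<eta> 0 = 0" and eta_1 [simp]: "\<eta> 1 = 1"
  by (simp_all add: quadratic_character_def)

lemma eta_cases: "s \<noteq> 0 \<Longrightarrow> \<eta> s = 1 \<or> \<eta> s = - 1"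
  by (simp add: quadratic_character_def)

lemma eta_square [simp]: "s \<noteq> 0 \<Longrightarrow> \<eta> (s\<^sup>2) = 1"
  using eta_cases[of s] by (auto simp: power2_eq_square eta_mult)

lemma norm_eta: "s \<noteq> 0 \<Longrightarrow> norm (\<eta> s) = 1"
  using eta_cases[of s] by auto

text \<open>
  Squaring is at most two-to-one, so there are at least \<open>h = (q - 1)/2\<close> nonzero squares. They are roots of \<open>X^h - 1\<close>, which
  has at most \<open>h\<close> roots, so they are all of them.
\<close>
lemma eta_eq_1_imp_square:
  assumes "s \<noteq> 0" "\<eta> s = 1" shows "\<exists>x. s = x\<^sup>2"
proof -
  define h where "h = (CARD('a) - 1) div 2"
  have h: "CARD('a) - 1 = 2 * h" "h > 0" using odd_card card_ge_2 by (auto simp: h_def elim!: oddE)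
  define P :: "'a poly" where "P = Polynomial.monom 1 h - 1"
  have "Polynomial.coeff P h = 1" using h by (simp add: P_def)
  then have P0: "P \<noteq> 0" by auto
  have deg: "Polynomial.degree P \<le> h"
    unfolding P_def by (intro degree_diff_le) (auto simp: degree_monom_le)
  define sq where "sq = (\<lambda>x :: 'a. x\<^sup>2) ` (- {0})"
  have sub: "sq \<subseteq> {x. poly P x = 0}"
  proof
    fix y assume "y \<in> sq"
    then obtain x where x: "x \<noteq> 0" "y = x\<^sup>2" by (auto simp: sq_def)
    then have "\<eta> y = 1" by simp
    then show "y \<in> {x. poly P x = 0}"
      using x by (auto simp: P_def poly_monom h_def quadratic_character_def split: if_splits)
  qed
  have "2 * h = card (- {0 :: 'a})" using h by (simp add: Compl_eq_Diff_UNIV)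
  also have "\<dots> \<le> card (\<Union>y\<in>sq. {x :: 'a. x\<^sup>2 = y})"
    by (intro card_mono) (auto simp: sq_def)
  also have "\<dots> \<le> (\<Sum>y\<in>sq. card {x :: 'a. x\<^sup>2 = y})"
    by (intro card_UN_le) auto
  also have "\<dots> \<le> (\<Sum>y\<in>sq. 2)"
  proof (rule sum_mono)
    fix y assume "y \<in> sq"
    then obtain x where "y = x\<^sup>2" by (auto simp: sq_def)
    then have "{z :: 'a. z\<^sup>2 = y} \<subseteq> {x, - x}" by (auto simp: power2_eq_iff)
    then have "card {z :: 'a. z\<^sup>2 = y} \<le> card {x, - x}" by (intro card_mono) auto
    also have "\<dots> \<le> 2" by (simp add: card_insert_if)
    finally show "card {z :: 'a. z\<^sup>2 = y} \<le> 2" .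
  qed
  finally have "h \<le> card sq" by simp
  moreover have "card {x. poly P x = 0} \<le> h"
    using card_poly_roots_bound[OF P0] deg by simp
  ultimately have "sq = {x. poly P x = 0}"
    by (intro card_seteq[OF _ sub]) auto
  moreover have "poly P s = 0"
    using assms one_neq_minus_one
    by (auto simp: P_def poly_monom h_def quadratic_character_def split: if_splits)
  ultimately show ?thesis by (auto simp: sq_def)
qed

lemma card_square_roots: "of_nat (card {x. x\<^sup>2 = s}) = 1 + \<eta> s"
proof (cases "s = 0")
  case True
  then show ?thesis by simp
next
  case False
  show ?thesis
  proof (cases "\<eta> s = 1")
    case True
    then obtain x where x: "s = x\<^sup>2" using eta_eq_1_imp_square False by blast
    then have "{y. y\<^sup>2 = s} = {x, - x}" by (auto simp: power2_eq_iff)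
    moreover have "x \<noteq> - x"
    proof
      assume "x = - x"
      then have "2 * x = 0" by (metis add.right_inverse mult_2)
      then show False using two_neq_0 False x by simp
    qed
    ultimately show ?thesis using True by simp
  next
    case False': False
    then have "\<eta> s = - 1" using eta_cases False by blast
    moreover have "{y. y\<^sup>2 = s} = {}" using False' False by auto
    ultimately show ?thesis by simp
  qed
qed

text \<open>
  Multiply the sum by its conjugate and put \<open>x = y + h\<close>: the exponent becomes \<open>Q h + B y h\<close>, and the sum over \<open>y\<close> vanishes
  unless \<open>h = 0\<close>. The domain is an arbitrary finite group because the lemma is applied both to the field itself and to
  the space of vectors.
\<close>
lemma norm_quadratic_gauss_sum:
  fixes Q :: "'v::{ab_group_add,finite} \<Rightarrow> 'a"
  assumes polar: "\<And>x y. Q (x + y) = Q x + Q y + B x y"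
    and additive: "\<And>x y z. B (x + y) z = B x z + B y z"
    and nondeg: "\<And>h. h \<noteq> 0 \<Longrightarrow> \<exists>z. \<psi> (B z h) \<noteq> 1"
  shows "(norm (\<Sum>x\<in>UNIV. \<psi> (Q x)))\<^sup>2 = real CARD('v)"
proof -
  have B0: "B x 0 = 0" "Q 0 = 0" for x
  proof -
    have "B 0 z = 0" for z
    proof -
      have "B 0 z + B 0 z = B 0 z + 0" using additive[of 0 0 z] by (simp only: add_0_left add_0_right)
      then show ?thesis by (simp only: add_left_cancel)
    qed
    then have "Q 0 + 0 = Q 0 + Q 0" using polar[of 0 0] by (simp only: add_0_left add_0_right)
    then show "Q 0 = 0" by (simp only: add_left_cancel)
    then show "B x 0 = 0" using polar[of x 0] by simp
  qed
  have "complex_of_real ((norm (\<Sum>x\<in>UNIV. \<psi> (Q x)))\<^sup>2)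
      = (\<Sum>y\<in>UNIV. \<Sum>x\<in>UNIV. \<psi> (Q x - Q y))"
    unfolding complex_norm_square cnj_sum sum_product psi_diff by (rule sum.swap)
  also have "\<dots> = (\<Sum>y\<in>UNIV. \<Sum>h\<in>UNIV. \<psi> (Q h) * \<psi> (B y h))"
  proof (rule sum.cong)
    fix y :: 'v
    have "(\<Sum>x\<in>UNIV. \<psi> (Q x - Q y)) = (\<Sum>h\<in>UNIV. \<psi> (Q (y + h) - Q y))"
      by (rule sum.reindex_bij_witness[of _ "\<lambda>h. y + h" "\<lambda>x. x - y"]) auto
    also have "\<dots> = (\<Sum>h\<in>UNIV. \<psi> (Q h) * \<psi> (B y h))"
      using polar[of y] by (simp flip: psi_add)
    finally show "(\<Sum>x\<in>UNIV. \<psi> (Q x - Q y)) = (\<Sum>h\<in>UNIV. \<psi> (Q h) * \<psi> (B y h))" .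
  qed simp
  also have "\<dots> = (\<Sum>h\<in>UNIV. \<psi> (Q h) * (\<Sum>y\<in>UNIV. \<psi> (B y h)))"
    unfolding sum_distrib_left by (rule sum.swap)
  also have "\<dots> = (\<Sum>h::'v\<in>UNIV. if h = 0 then of_nat CARD('v) else 0)"
  proof (rule sum.cong)
    fix h :: 'v
    show "\<psi> (Q h) * (\<Sum>y\<in>UNIV. \<psi> (B y h)) = (if h = 0 then of_nat CARD('v) else 0)"
    proof (cases "h = 0")
      case True
      then show ?thesis by (simp add: B0)
    next
      case False
      then obtain z where "\<psi> (B z h) \<noteq> 1" using nondeg by blast
      then show ?thesis
        using False sum_psi_additive_map[of "\<lambda>y. B y h" z] additive by simp
    qed
  qed simp
  also have "\<dots> = complex_of_real (real CARD('v))" by simp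
  finally show ?thesis by (simp only: of_real_eq_iff)
qed

definition gauss_sum :: complex where "gauss_sum = (\<Sum>y\<in>UNIV. \<eta> y * \<psi> y)"

lemma norm_gauss_sum: "norm gauss_sum = sqrt (real CARD('a))"
proof -
  have "(\<Sum>x\<in>UNIV. \<psi> (x\<^sup>2)) = (\<Sum>y\<in>UNIV. \<Sum>x | x \<in> UNIV \<and> x\<^sup>2 = y. \<psi> (x\<^sup>2))"
    by (rule sum.group[symmetric]) auto
  also have "\<dots> = (\<Sum>y\<in>UNIV. of_nat (card {x. x\<^sup>2 = y}) * \<psi> y)"
    by (intro sum.cong refl) simp
  also have "\<dots> = (\<Sum>y\<in>UNIV. \<psi> y) + gauss_sum"
    by (simp add: card_square_roots gauss_sum_def distrib_right sum.distrib)
  also have "(\<Sum>y\<in>UNIV. \<psi> y) = 0" using sum_psi_mult[of 1] by simp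
  finally have "gauss_sum = (\<Sum>x\<in>UNIV. \<psi> (x\<^sup>2))" by simp
  moreover have "(norm (\<Sum>x\<in>UNIV. \<psi> (x\<^sup>2)))\<^sup>2 = real CARD('a)"
  proof (rule norm_quadratic_gauss_sum)
    show "(x + y)\<^sup>2 = x\<^sup>2 + y\<^sup>2 + 2 * y * x" for x y :: 'a by (simp add: power2_sum)
    show "\<exists>z. \<psi> (2 * h * z) \<noteq> 1" if "h \<noteq> 0" for h
      using psi_mult_nontrivial[of "2 * h"] two_neq_0 that by simp
  qed (simp add: algebra_simps)
  ultimately show ?thesis by (metis norm_ge_zero real_sqrt_unique)
qed

lemma sum_eta_psi_shift: "(\<Sum>y\<in>UNIV. \<psi> y * \<eta> (y + c)) = \<psi> (- c) * gauss_sum"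
proof -
  have "(\<Sum>y\<in>UNIV. \<psi> y * \<eta> (y + c)) = (\<Sum>y\<in>UNIV. \<psi> (y + - c) * \<eta> y)"
    by (rule sum.reindex_bij_witness[of _ "\<lambda>y. y - c" "\<lambda>y. y + c"]) auto
  also have "\<dots> = \<psi> (- c) * gauss_sum"
    unfolding psi_add gauss_sum_def sum_distrib_left by (intro sum.cong) (auto simp: mult_ac)
  finally show ?thesis .
qed

text \<open>
  The solutions \<open>s\<close> of \<open>a s + b/s = y\<close> are those of \<open>(2 a s - y)^2 = (y + 2c)(y - 2c)\<close>, so their number is
  one plus the quadratic character of the right-hand side. Moreover \<open>(a s + e)^2 = a s (y + 2e)\<close> for \<open>e = c\<close> and \<open>e = -c\<close>,
  so \<open>\<eta> s = \<eta> a \<eta> (y + 2e)\<close> for whichever sign makes \<open>y + 2e\<close> nonzero.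
\<close>
lemma sum_eta_fibre:
  assumes a: "a \<noteq> 0" and c: "c \<noteq> 0" and ab: "a * b = c\<^sup>2"
  shows "(\<Sum>s | s \<noteq> 0 \<and> a * s + b / s = y. \<eta> s) = \<eta> a * (\<eta> (y + 2 * c) + \<eta> (y - 2 * c))"
proof -
  define S where "S = {s. s \<noteq> 0 \<and> a * s + b / s = y}"
  have S_eq: "S = {s. (2 * a * s - y)\<^sup>2 = (y + 2 * c) * (y - 2 * c)}"
  proof (intro Set.set_eqI)
    fix s
    have key: "(2 * a * s - y)\<^sup>2 - (y + 2 * c) * (y - 2 * c) = 4 * a * (a * s\<^sup>2 - y * s + b)"
    proof -
      have "(2 * a * s - y)\<^sup>2 - (y + 2 * c) * (y - 2 * c) = 4 * (a * s) * (a * s - y) + 4 * c\<^sup>2"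
        by (simp add: power2_eq_square algebra_simps)
      then show ?thesis unfolding ab[symmetric] by (simp add: power2_eq_square algebra_simps)
    qed
    have "(2 * a * s - y)\<^sup>2 = (y + 2 * c) * (y - 2 * c) \<longleftrightarrow> a * s\<^sup>2 - y * s + b = 0"
      using key a four_neq_0 by (metis eq_iff_diff_eq_0 mult_eq_0_iff)
    also have "\<dots> \<longleftrightarrow> s \<in> S"
    proof (cases "s = 0")
      case True
      have "b \<noteq> 0" using ab c by auto
      then show ?thesis using True by (simp add: S_def)
    next
      case False
      then have "a * s + b / s = y \<longleftrightarrow> a * s\<^sup>2 + b = y * s"
        by (simp add: field_simps power2_eq_square)
      then show ?thesis using False by (auto simp: S_def algebra_simps)
    qed
    finally show "s \<in> S \<longleftrightarrow> s \<in> {s. (2 * a * s - y)\<^sup>2 = (y + 2 * c) * (y - 2 * c)}" by simp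
  qed
  have "card S = card {x. x\<^sup>2 = (y + 2 * c) * (y - 2 * c)}"
  proof (rule bij_betw_same_card)
    show "bij_betw (\<lambda>s. 2 * a * s - y) S {x. x\<^sup>2 = (y + 2 * c) * (y - 2 * c)}"
      unfolding S_eq
      by (rule bij_betw_byWitness[where f' = "\<lambda>x. (x + y) / (2 * a)"])
         (use two_neq_0 a in \<open>auto simp: field_simps\<close>)
  qed
  then have card_S: "of_nat (card S) = 1 + \<eta> (y + 2 * c) * \<eta> (y - 2 * c)"
    by (simp add: card_square_roots eta_mult)
  have eta_S: "\<eta> s = \<eta> a * \<eta> (y + 2 * e)"
    if "s \<in> S" "y + 2 * e \<noteq> 0" "e\<^sup>2 = c\<^sup>2" for s e
  proof -
    have s: "s \<noteq> 0" "a * s\<^sup>2 + b = y * s"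
      using that by (auto simp: S_def field_simps power2_eq_square)
    have "(a * s + e)\<^sup>2 = a * (a * s\<^sup>2) + 2 * a * s * e + a * b"
      using that(3) ab by (simp add: power2_eq_square algebra_simps)
    also have "\<dots> = a * (a * s\<^sup>2 + b) + 2 * a * s * e" by (simp add: algebra_simps)
    also have "\<dots> = (a * s) * (y + 2 * e)" unfolding s(2) by (simp add: algebra_simps)
    finally have sq: "(a * s + e)\<^sup>2 = (a * s) * (y + 2 * e)" .
    then have "a * s + e \<noteq> 0" using that a s by auto
    then have "\<eta> a * \<eta> s * \<eta> (y + 2 * e) = 1"
      using sq eta_square[of "a * s + e"] by (simp add: eta_mult)
    then show ?thesis
      using eta_cases[OF a] eta_cases[OF s(1)] eta_cases[OF that(2)] by auto
  qed
  have fibre: "(\<Sum>s\<in>S. \<eta> s) = of_nat (card S) * (\<eta> a * \<eta> (y + 2 * e))"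
    if "y + 2 * e \<noteq> 0" "e\<^sup>2 = c\<^sup>2" for e
    using eta_S[OF _ that] by simp
  have "(\<Sum>s\<in>S. \<eta> s) = \<eta> a * (\<eta> (y + 2 * c) + \<eta> (y - 2 * c))"
  proof (cases "y + 2 * c = 0")
    case False
    then have "\<eta> (y + 2 * c) * \<eta> (y + 2 * c) = 1" using eta_cases by fastforce
    then show ?thesis unfolding fibre[OF False refl] card_S
      by (simp add: algebra_simps)
  next
    case True
    have "y + 2 * - c \<noteq> 0"
    proof
      assume "y + 2 * - c = 0"
      then have "(y + 2 * c) - (y + 2 * - c) = 0" using True by simp
      then have "4 * c = 0" by simp
      then show False using four_neq_0 c by simp
    qed
    then show ?thesis using fibre[of "- c"] card_S True by simp
  qed
  then show ?thesis by (simp add: S_def)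
qed

text \<open>
  For \<open>b = 0\<close> the sum is \<open>\<eta> a\<close> times the Gauss sum. If \<open>a b\<close> is a nonsquare, the substitution of \<open>b/(a s)\<close> for \<open>s\<close> turns the sum into its negative. If \<open>a b = c^2\<close>, grouping by
  the value of \<open>a s + b/s\<close> evaluates it as the Gauss sum times \<open>\<eta> a (\<psi> (2c) + \<psi> (-2c))\<close>.
\<close>
theorem norm_salie_sum_le:
  assumes a: "a \<noteq> 0"
  shows "norm (\<Sum>s\<in>-{0}. \<eta> s * \<psi> (a * s + b / s)) \<le> 2 * sqrt (real CARD('a))"
proof -
  define T where "T = (\<Sum>s\<in>-{0}. \<eta> s * \<psi> (a * s + b / s))"
  consider (zero) "b = 0" | (square) c where "c \<noteq> 0" "a * b = c\<^sup>2" | (nonsquare) "b \<noteq> 0" "\<eta> (a * b) = - 1"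
  proof (cases "b = 0")
    case False
    then have ab: "a * b \<noteq> 0" using a by simp
    show thesis
    proof (cases "\<eta> (a * b) = 1")
      case True
      then obtain c where c: "a * b = c\<^sup>2" using eta_eq_1_imp_square[OF ab] by blast
      then have "c \<noteq> 0" using ab by auto
      then show thesis using c square by blast
    next
      case False': False
      then show thesis using False nonsquare eta_cases[OF ab] by blast
    qed
  qed (rule zero)
  then have "norm T \<le> 2 * sqrt (real CARD('a))"
  proof cases
    case zero
    have "T = (\<Sum>s\<in>UNIV. \<eta> s * \<psi> (a * s))"
      unfolding T_def by (rule sum.mono_neutral_cong_left) (auto simp: zero)
    also have "\<dots> = (\<Sum>y\<in>UNIV. \<eta> a * (\<eta> y * \<psi> y))"
    proof (rule sum.reindex_bij_witness[of _ "\<lambda>y. y / a" "\<lambda>s. a * s"])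
      fix s
      show "\<eta> a * (\<eta> (a * s) * \<psi> (a * s)) = \<eta> s * \<psi> (a * s)"
        using eta_cases[OF a] by (auto simp: eta_mult)
    qed (use a in auto)
    also have "\<dots> = \<eta> a * gauss_sum" by (simp add: gauss_sum_def sum_distrib_left)
    finally show ?thesis using a by (simp add: norm_mult norm_eta norm_gauss_sum)
  next
    case nonsquare
    have "T = (\<Sum>s\<in>-{0}. \<eta> (b / (a * s)) * \<psi> (a * (b / (a * s)) + b / (b / (a * s))))"
      unfolding T_def
      by (rule sum.reindex_bij_witness[of _ "\<lambda>s. b / (a * s)" "\<lambda>s. b / (a * s)"])
         (use a nonsquare in auto)
    also have "\<dots> = (\<Sum>s\<in>-{0}. \<eta> (a * b) * (\<eta> s * \<psi> (a * s + b / s)))"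
    proof (rule sum.cong)
      fix s assume s: "s \<in> - {0 :: 'a}"
      then have "b / (a * s) * (a * s)\<^sup>2 = (a * b) * s" using a by (simp add: power2_eq_square)
      then have "\<eta> (b / (a * s)) * \<eta> ((a * s)\<^sup>2) = \<eta> (a * b) * \<eta> s" by (simp only: eta_mult[symmetric])
      then have "\<eta> (b / (a * s)) = \<eta> (a * b) * \<eta> s" using a s by (simp del: power_mult_distrib)
      moreover have "a * (b / (a * s)) + b / (b / (a * s)) = a * s + b / s"
        using a s nonsquare by simp
      ultimately show "\<eta> (b / (a * s)) * \<psi> (a * (b / (a * s)) + b / (b / (a * s)))
          = \<eta> (a * b) * (\<eta> s * \<psi> (a * s + b / s))" by simp
    qed simp
    also have "\<dots> = - T" by (simp add: nonsquare T_def sum_negf)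
    finally have "T = 0" by simp
    then show ?thesis by simp
  next
    case square
    have "T = (\<Sum>y\<in>UNIV. \<Sum>s | s \<in> -{0} \<and> a * s + b / s = y. \<eta> s * \<psi> (a * s + b / s))"
      unfolding T_def by (rule sum.group[symmetric]) auto
    also have "\<dots> = (\<Sum>y\<in>UNIV. \<psi> y * (\<Sum>s | s \<noteq> 0 \<and> a * s + b / s = y. \<eta> s))"
      by (intro sum.cong refl) (simp add: sum_distrib_left mult.commute)
    also have "\<dots> = (\<Sum>y\<in>UNIV. \<psi> y * (\<eta> a * (\<eta> (y + 2 * c) + \<eta> (y + - (2 * c)))))"
      by (simp add: sum_eta_fibre[OF a square])
    also have "\<dots> = \<eta> a * ((\<Sum>y\<in>UNIV. \<psi> y * \<eta> (y + 2 * c)) + (\<Sum>y\<in>UNIV. \<psi> y * \<eta> (y + - (2 * c))))"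
      by (simp add: sum_distrib_left sum.distrib algebra_simps)
    also have "\<dots> = \<eta> a * gauss_sum * (\<psi> (- (2 * c)) + \<psi> (2 * c))"
      unfolding sum_eta_psi_shift by (simp add: algebra_simps)
    finally have "norm T = sqrt (real CARD('a)) * norm (\<psi> (- (2 * c)) + \<psi> (2 * c))"
      using a by (simp add: norm_mult norm_eta norm_gauss_sum)
    also have "\<dots> \<le> sqrt (real CARD('a)) * 2"
      using norm_triangle_ineq[of "\<psi> (- (2 * c))" "\<psi> (2 * c)"] by (intro mult_left_mono) auto
    finally show ?thesis by simp
  qed
  then show ?thesis by (simp add: T_def)
qed

end

section \<open>The operator bound for bilinear forms\<close>

lemma bilinear_form_simps:
  assumes "bilinear_form B"
  shows "B (x + y) z = B x z + B y z" "B z (x + y) = B z x + B z y"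
    and "B (c *s x) z = c * B x z" "B z (c *s x) = c * B z x"
  using assms
  by (auto simp: bilinear_form_def Vector_Spaces.linear_def module_hom_iff)

lemma parseval:
  fixes \<kappa> :: "'m::finite \<Rightarrow> 'x::finite \<Rightarrow> complex"
  assumes "\<And>x y. (\<Sum>m\<in>UNIV. \<kappa> m x * cnj (\<kappa> m y)) = (if x = y then of_real N else 0)"
  shows "(\<Sum>m\<in>UNIV. (norm (\<Sum>x\<in>UNIV. f x * \<kappa> m x))\<^sup>2) = N * (\<Sum>x\<in>UNIV. (norm (f x))\<^sup>2)"
proof -
  have "complex_of_real (\<Sum>m\<in>UNIV. (norm (\<Sum>x\<in>UNIV. f x * \<kappa> m x))\<^sup>2)
      = (\<Sum>m\<in>UNIV. \<Sum>x\<in>UNIV. \<Sum>y\<in>UNIV. f x * cnj (f y) * (\<kappa> m x * cnj (\<kappa> m y)))"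
    unfolding of_real_sum complex_norm_square cnj_sum sum_product
    by (intro sum.cong refl) simp
  also have "\<dots> = (\<Sum>x\<in>UNIV. \<Sum>y\<in>UNIV. \<Sum>m\<in>UNIV. f x * cnj (f y) * (\<kappa> m x * cnj (\<kappa> m y)))"
    by (subst sum.swap, rule sum.cong[OF refl], rule sum.swap)
  also have "\<dots> = (\<Sum>x\<in>UNIV. \<Sum>y\<in>UNIV. if x = y then of_real N * (f x * cnj (f y)) else 0)"
    unfolding sum_distrib_left[symmetric] assms by (intro sum.cong refl) simp
  also have "\<dots> = of_real (N * (\<Sum>x\<in>UNIV. (norm (f x))\<^sup>2))"
    unfolding of_real_mult of_real_sum complex_norm_square sum_distrib_left by simp
  finally show ?thesis by (simp only: of_real_eq_iff)
qed

context odd_field_character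
begin

lemma indicator_minus_mean:
  "(if c = 0 then 1 else 0) - 1 / of_nat CARD('a) = (\<Sum>s\<in>-{0}. \<psi> (c * s)) / of_nat CARD('a)"
proof -
  have "(\<Sum>s\<in>UNIV. \<psi> (c * s)) = 1 + (\<Sum>s\<in>-{0}. \<psi> (c * s))"
    by (subst sum.remove[of _ 0]) (auto simp: Compl_eq_Diff_UNIV)
  then have "(\<Sum>s\<in>-{0}. \<psi> (c * s)) = (if c = 0 then of_nat CARD('a) else 0) - 1"
    by (metis sum_psi_mult add_diff_cancel_left')
  then show ?thesis by (simp add: diff_divide_distrib)
qed

lemma norm_inverse_sum_le:
  assumes "a \<noteq> 0"
  shows "norm (\<Sum>s\<in>-{0}. \<psi> (a * s + b / s)) \<le> 2 * sqrt (real CARD('a))"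
proof (cases "b = 0")
  case True
  have "(\<Sum>s\<in>-{0}. \<psi> (a * s)) = - 1"
    using indicator_minus_mean[of a] assms by (simp add: field_simps)
  moreover have "1 \<le> 2 * sqrt (real CARD('a))"
  proof -
    have "sqrt (real CARD('a)) \<ge> 1" using card_ge_2 by simp
    then show ?thesis by linarith
  qed
  ultimately show ?thesis using True by simp
next
  case False
  then show ?thesis using kloosterman_sum_le[OF odd_card additive_character assms] by simp
qed

lemma character_orthogonality:
  fixes B :: "'a ^ 'n::finite \<Rightarrow> 'a ^ 'n \<Rightarrow> 'a"
  assumes B: "bilinear_form B" "nondegenerate_form B"
  shows "(\<Sum>m\<in>UNIV. \<psi> (B m x) * cnj (\<psi> (B m y)))
    = (if x = y then of_real (real CARD('a) ^ CARD('n)) else 0)"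
proof -
  have B_diff: "B m (x - y) = B m x - B m y" for m
    using bilinear_form_simps(2)[OF B(1), of m "x - y" y] by simp
  have eq: "(\<Sum>m\<in>UNIV. \<psi> (B m x) * cnj (\<psi> (B m y))) = (\<Sum>m\<in>UNIV. \<psi> (B m (x - y)))"
    by (simp add: B_diff psi_diff)
  show ?thesis
  proof (cases "x = y")
    case True
    have "B m 0 = 0" for m using bilinear_form_simps(4)[OF B(1), of m 0 0] by simp
    then show ?thesis using True eq by simp
  next
    case False
    then have "x - y \<noteq> 0" by simp
    then obtain z where z: "B z (x - y) \<noteq> 0" using B(2) unfolding nondegenerate_form_def by blast
    then obtain c where "\<psi> (B z (x - y) * c) \<noteq> 1" using psi_mult_nontrivial by blast
    then have "\<psi> (B (c *s z) (x - y)) \<noteq> 1"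
      by (simp add: bilinear_form_simps(3)[OF B(1)] mult.commute)
    then show ?thesis
      using False eq sum_psi_additive_map[of "\<lambda>m. B m (x - y)" "c *s z"] bilinear_form_simps(1)[OF B(1)]
      by simp
  qed
qed

text \<open>
  Expanding the indicator in characters gives \<open>M x = (1/q) \<Sum> \<psi> (-t s) F (s x)\<close> over nonzero \<open>s\<close>, where \<open>F\<close> is a Fourier transform
  of \<open>f\<close>. Estimating the terms one by one would lose a factor \<open>\<surd>q\<close>. Instead, along the line through \<open>x\<close> the values
  \<open>M (c x)\<close> are themselves Fourier coefficients, at \<open>1/c\<close>, of the function taking \<open>u\<close> to \<open>F (u x)\<close>, so Bessel's inequality applies on
  every line; averaging over lines and Parseval's identity for \<open>F\<close> finish the proof.
\<close>
lemma bilinear_operator_bound: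
  fixes B :: "'a ^ 'n::finite \<Rightarrow> 'a ^ 'n \<Rightarrow> 'a" and f :: "'a ^ 'n \<Rightarrow> complex"
  assumes B: "bilinear_form B" "nondegenerate_form B" and t: "t \<noteq> 0"
  shows "(\<Sum>x\<in>UNIV. (norm (\<Sum>y\<in>UNIV. ((if B x y = t then 1 else 0) - 1 / of_nat CARD('a)) * f y))\<^sup>2)
    \<le> real CARD('a) ^ (CARD('n) - 1) * (\<Sum>y\<in>UNIV. (norm (f y))\<^sup>2)"
proof -
  let ?q = "real CARD('a)"
  define M where "M x = (\<Sum>y\<in>UNIV. ((if B x y = t then 1 else 0) - 1 / of_nat CARD('a)) * f y)" for x
  define F where "F x = (\<Sum>y\<in>UNIV. f y * \<psi> (B x y))" for x
  have q: "?q > 1" using card_ge_2 by simp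
  have M_eq: "M x = (\<Sum>s\<in>-{0}. \<psi> (- t * s) * F (s *s x)) / of_nat CARD('a)" for x
  proof -
    have "M x = (\<Sum>y\<in>UNIV. (\<Sum>s\<in>-{0}. \<psi> ((B x y - t) * s)) / of_nat CARD('a) * f y)"
      unfolding M_def indicator_minus_mean[symmetric] by simp
    also have "\<dots> = (\<Sum>y\<in>UNIV. \<Sum>s\<in>-{0}. \<psi> (- t * s) * (f y * \<psi> (B (s *s x) y))) / of_nat CARD('a)"
    proof -
      have "\<psi> ((B x y - t) * s) = \<psi> (- t * s) * \<psi> (B (s *s x) y)" for y s
        by (simp add: bilinear_form_simps(3)[OF B(1)] algebra_simps flip: psi_add)
      then show ?thesis
        by (simp add: sum_divide_distrib sum_distrib_left sum_distrib_right mult_ac)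
    qed
    also have "\<dots> = (\<Sum>s\<in>-{0}. \<psi> (- t * s) * F (s *s x)) / of_nat CARD('a)"
      unfolding F_def sum_distrib_left by (subst sum.swap) simp
    finally show ?thesis .
  qed
  have line: "(\<Sum>c\<in>-{0}. (norm (M (c *s x)))\<^sup>2) \<le> (\<Sum>u\<in>-{0}. (norm (F (u *s x)))\<^sup>2) / ?q" for x
  proof -
    define g where "g u = (if u = 0 then 0 else F (u *s x))" for u
    have M_c: "M (c *s x) = (\<Sum>u\<in>UNIV. g u * \<psi> (- t * (1 / c) * u)) / of_nat CARD('a)" if "c \<noteq> 0" for c
    proof -
      have "(\<Sum>s\<in>-{0}. \<psi> (- t * s) * F (s *s (c *s x))) = (\<Sum>u\<in>-{0}. g u * \<psi> (- t * (1 / c) * u))"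
        by (rule sum.reindex_bij_witness[of _ "\<lambda>u. u / c" "\<lambda>s. s * c"])
           (use that in \<open>auto simp: g_def\<close>)
      also have "\<dots> = (\<Sum>u\<in>UNIV. g u * \<psi> (- t * (1 / c) * u))"
        by (intro sum.mono_neutral_left) (auto simp: g_def)
      finally show ?thesis unfolding M_eq by simp
    qed
    have "(\<Sum>c\<in>-{0}. (norm (M (c *s x)))\<^sup>2)
        = (\<Sum>c\<in>-{0}. (norm (\<Sum>u\<in>UNIV. g u * \<psi> (- t * (1 / c) * u)))\<^sup>2 / ?q\<^sup>2)"
      by (intro sum.cong refl) (simp add: M_c norm_divide power_divide)
    also have "\<dots> = (\<Sum>w\<in>-{0}. (norm (\<Sum>u\<in>UNIV. g u * \<psi> (- t * w * u)))\<^sup>2 / ?q\<^sup>2)"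
      by (rule sum.reindex_bij_witness[of _ "\<lambda>w. 1 / w" "\<lambda>c. 1 / c"]) auto
    also have "\<dots> \<le> (\<Sum>w\<in>UNIV. (norm (\<Sum>u\<in>UNIV. g u * \<psi> (- t * w * u)))\<^sup>2 / ?q\<^sup>2)"
      by (intro sum_mono2) auto
    also have "\<dots> = (\<Sum>w\<in>UNIV. (norm (\<Sum>u\<in>UNIV. g u * \<psi> (- t * w * u)))\<^sup>2) / ?q\<^sup>2"
      by (simp add: sum_divide_distrib)
    also have "(\<Sum>w\<in>UNIV. (norm (\<Sum>u\<in>UNIV. g u * \<psi> (- t * w * u)))\<^sup>2) = ?q * (\<Sum>u\<in>UNIV. (norm (g u))\<^sup>2)"
    proof (rule parseval)
      fix u v
      have "\<psi> (- t * w * u) * cnj (\<psi> (- t * w * v)) = \<psi> ((- t * (u - v)) * w)" for w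
        by (simp add: algebra_simps flip: psi_diff)
      then show "(\<Sum>w\<in>UNIV. \<psi> (- t * w * u) * cnj (\<psi> (- t * w * v))) = (if u = v then of_real ?q else 0)"
        using sum_psi_mult[of "- t * (u - v)"] t by simp
    qed
    also have "(\<Sum>u\<in>UNIV. (norm (g u))\<^sup>2) = (\<Sum>u\<in>-{0}. (norm (F (u *s x)))\<^sup>2)"
      by (rule sum.mono_neutral_cong_right) (auto simp: g_def)
    also have "?q * (\<Sum>u\<in>-{0}. (norm (F (u *s x)))\<^sup>2) / ?q\<^sup>2 = (\<Sum>u\<in>-{0}. (norm (F (u *s x)))\<^sup>2) / ?q"
      using q by (simp add: power2_eq_square)
    finally show ?thesis .
  qed
  have dilate: "(\<Sum>x\<in>UNIV. \<Sum>c\<in>-{0}. h (c *s x)) = (?q - 1) * (\<Sum>x\<in>UNIV. h x)"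
    for h :: "'a ^ 'n \<Rightarrow> real"
  proof -
    have "(\<Sum>x\<in>UNIV. \<Sum>c\<in>-{0}. h (c *s x)) = (\<Sum>c\<in>-{0}. \<Sum>x\<in>UNIV. h (c *s x))" by (rule sum.swap)
    also have "\<dots> = (\<Sum>c\<in>-{0 :: 'a}. \<Sum>x\<in>UNIV. h x)"
    proof (rule sum.cong)
      fix c :: 'a assume "c \<in> - {0}"
      then show "(\<Sum>x\<in>UNIV. h (c *s x)) = (\<Sum>x\<in>UNIV. h x)"
        by (intro sum.reindex_bij_witness[of _ "\<lambda>x. (1 / c) *s x" "\<lambda>x. c *s x"]) auto
    qed simp
    also have "\<dots> = (?q - 1) * (\<Sum>x\<in>UNIV. h x)"
      by (simp add: Compl_eq_Diff_UNIV of_nat_diff)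
    finally show ?thesis .
  qed
  have "(?q - 1) * (\<Sum>x\<in>UNIV. (norm (M x))\<^sup>2) = (\<Sum>x\<in>UNIV. \<Sum>c\<in>-{0}. (norm (M (c *s x)))\<^sup>2)"
    using dilate[of "\<lambda>x. (norm (M x))\<^sup>2"] by simp
  also have "\<dots> \<le> (\<Sum>x\<in>UNIV. (\<Sum>u\<in>-{0}. (norm (F (u *s x)))\<^sup>2) / ?q)"
    by (intro sum_mono line)
  also have "\<dots> = (?q - 1) * ((\<Sum>x\<in>UNIV. (norm (F x))\<^sup>2) / ?q)"
    using dilate[of "\<lambda>x. (norm (F x))\<^sup>2"] by (simp flip: sum_divide_distrib)
  also have "(\<Sum>x\<in>UNIV. (norm (F x))\<^sup>2) = ?q ^ CARD('n) * (\<Sum>y\<in>UNIV. (norm (f y))\<^sup>2)"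
    unfolding F_def by (rule parseval) (rule character_orthogonality[OF B])
  also have "?q ^ CARD('n) * (\<Sum>y\<in>UNIV. (norm (f y))\<^sup>2) / ?q
      = ?q ^ (CARD('n) - 1) * (\<Sum>y\<in>UNIV. (norm (f y))\<^sup>2)"
    using q by (simp add: power_eq_if[of ?q "CARD('n)"])
  finally show ?thesis using q by (simp add: M_def)
qed

section \<open>The operator bound for quadratic forms\<close>

lemma quadratic_form_simps:
  assumes "quadratic_form Q"
  shows "Q (c *s x) = c\<^sup>2 * Q x" "Q (x + y) = Q x + Q y + polar_form Q x y"
    "polar_form Q x y = polar_form Q y x" "bilinear_form (polar_form Q)"
  using assms by (auto simp: quadratic_form_def polar_form_def add.commute)

definition form_gauss_sum :: "('a ^ 'n::finite \<Rightarrow> 'a) \<Rightarrow> 'a \<Rightarrow> complex" where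
  "form_gauss_sum Q s = (\<Sum>x\<in>UNIV. \<psi> (s * Q x))"

lemma norm_form_gauss_sum:
  fixes Q :: "'a ^ 'n::finite \<Rightarrow> 'a"
  assumes "nondegenerate_quadratic_form Q" "s \<noteq> 0"
  shows "norm (form_gauss_sum Q s) = sqrt (real CARD('a) ^ CARD('n))"
proof -
  have Q: "quadratic_form Q" "nondegenerate_form (polar_form Q)"
    using assms(1) by (auto simp: nondegenerate_quadratic_form_def)
  note simps = quadratic_form_simps[OF Q(1)]
  have "(norm (form_gauss_sum Q s))\<^sup>2 = real CARD('a ^ 'n)"
    unfolding form_gauss_sum_def
  proof (rule norm_quadratic_gauss_sum)
    show "s * Q (x + y) = s * Q x + s * Q y + s * polar_form Q x y" for x y
      by (simp add: simps(2) algebra_simps)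
    show "s * polar_form Q (x + y) z = s * polar_form Q x z + s * polar_form Q y z" for x y z
      by (simp add: bilinear_form_simps(1)[OF simps(4)] algebra_simps)
    show "\<exists>z. \<psi> (s * polar_form Q z h) \<noteq> 1" if "h \<noteq> 0" for h
    proof -
      obtain z where "polar_form Q z h \<noteq> 0" using Q(2) \<open>h \<noteq> 0\<close> by (auto simp: nondegenerate_form_def)
      then obtain c where "\<psi> (s * polar_form Q z h * c) \<noteq> 1"
        using psi_mult_nontrivial[of "s * polar_form Q z h"] assms(2) by auto
      then show ?thesis
        by (intro exI[of _ "c *s z"]) (simp add: bilinear_form_simps(3)[OF simps(4)] mult_ac)
    qed
  qed
  then show ?thesis by (simp add: real_sqrt_unique)
qed

text \<open>
  By pigeonhole: the sets of values \<open>x^2\<close> and \<open>s - y^2\<close> each contain more than half of the field.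
\<close>
lemma sum_of_two_squares:
  fixes s :: 'a
  shows "\<exists>x y. s = x\<^sup>2 + y\<^sup>2"
proof -
  define A where "A = range (\<lambda>x :: 'a. x\<^sup>2)"
  define B where "B = (\<lambda>x. s - x) ` A"
  have "CARD('a) \<le> card (\<Union>y\<in>A. {x :: 'a. x\<^sup>2 = y})"
    by (intro card_mono) (auto simp: A_def)
  also have "\<dots> \<le> (\<Sum>y\<in>A. card {x :: 'a. x\<^sup>2 = y})"
    by (intro card_UN_le) auto
  also have "\<dots> \<le> (\<Sum>y\<in>A. 2)"
  proof (rule sum_mono)
    fix y assume "y \<in> A"
    then obtain x where "y = x\<^sup>2" by (auto simp: A_def)
    then have "{z :: 'a. z\<^sup>2 = y} \<subseteq> {x, - x}" by (auto simp: power2_eq_iff)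
    then have "card {z :: 'a. z\<^sup>2 = y} \<le> card {x, - x}" by (intro card_mono) auto
    also have "\<dots> \<le> 2" by (simp add: card_insert_if)
    finally show "card {z :: 'a. z\<^sup>2 = y} \<le> 2" .
  qed
  finally have "CARD('a) \<le> 2 * card A" by simp
  moreover have "CARD('a) \<noteq> 2 * card A" using odd_card by auto
  ultimately have "CARD('a) < 2 * card A" by linarith
  moreover have "card B = card A" unfolding B_def by (intro card_image) (auto simp: inj_on_def)
  ultimately have "card A + card B > CARD('a)" by simp
  moreover have "card (A \<union> B) \<le> CARD('a)" by (intro card_mono) auto
  ultimately have "A \<inter> B \<noteq> {}" using card_Un_disjoint[of A B] by fastforce
  then obtain x y where "x\<^sup>2 = s - y\<^sup>2" by (auto simp: A_def B_def)
  then show ?thesis by (metis diff_add_cancel)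
qed

text \<open>
  If \<open>s = a^2 + b^2\<close>, then \<open>(x, y) \<mapsto> (a x + b y, b x - a y)\<close> is an invertible map carrying \<open>s (Q x + Q y)\<close> to \<open>Q + Q\<close>:
  the polar terms cancel. So two copies of \<open>s Q\<close> have the same Gauss sum as two copies of \<open>Q\<close>.
\<close>
lemma form_gauss_sum_square:
  fixes Q :: "'a ^ 'n::finite \<Rightarrow> 'a"
  assumes Q: "quadratic_form Q" and s: "s \<noteq> 0"
  shows "(form_gauss_sum Q s)\<^sup>2 = (form_gauss_sum Q 1)\<^sup>2"
proof -
  note simps = quadratic_form_simps[OF Q]
  note bil = bilinear_form_simps[OF simps(4)]
  obtain a b where ab: "s = a\<^sup>2 + b\<^sup>2" using sum_of_two_squares by blast
  have square: "(form_gauss_sum Q r)\<^sup>2 = (\<Sum>(x, y)\<in>UNIV. \<psi> (r * (Q x + Q y)))" for r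
    by (simp add: form_gauss_sum_def power2_eq_square sum_product distrib_left psi_add
        sum.cartesian_product flip: UNIV_Times_UNIV)
  have rotate: "Q (a *s x + b *s y) + Q (b *s x + (- a) *s y) = s * (Q x + Q y)" for x y
    unfolding simps(1,2) bil ab by (simp add: algebra_simps)
  have inv1: "(a / s) *s (a *s x + b *s y) + (b / s) *s (b *s x + (- a) *s y) = x"
    and inv2: "(b / s) *s (a *s x + b *s y) + (- a / s) *s (b *s x + (- a) *s y) = y"
    and inv3: "a *s ((a / s) *s x + (b / s) *s y) + b *s ((b / s) *s x + (- a / s) *s y) = x"
    and inv4: "b *s ((a / s) *s x + (b / s) *s y) + (- a) *s ((b / s) *s x + (- a / s) *s y) = y" for x y :: "'a ^ 'n"
  proof -
    have "a * a / s + b * b / s = 1" using s ab by (simp add: power2_eq_square flip: add_divide_distrib)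
    moreover have "a * (a * w) / s + b * (b * w) / s = (a * a / s + b * b / s) * w" for w
      by (simp add: distrib_right mult.assoc)
    ultimately have one: "a * (a * w) / s + b * (b * w) / s = w" for w by simp
    show "(a / s) *s (a *s x + b *s y) + (b / s) *s (b *s x + (- a) *s y) = x"
      "(b / s) *s (a *s x + b *s y) + (- a / s) *s (b *s x + (- a) *s y) = y"
      "a *s ((a / s) *s x + (b / s) *s y) + b *s ((b / s) *s x + (- a / s) *s y) = x"
      "b *s ((a / s) *s x + (b / s) *s y) + (- a) *s ((b / s) *s x + (- a / s) *s y) = y"
      by (simp_all add: vec_eq_iff algebra_simps) (simp_all add: one)
  qed
  have "(form_gauss_sum Q s)\<^sup>2 = (\<Sum>(x, y)\<in>UNIV. \<psi> (1 * (Q x + Q y)))"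
    unfolding square
    by (rule sum.reindex_bij_witness[of _
          "\<lambda>(u, v). ((a / s) *s u + (b / s) *s v, (b / s) *s u + (- a / s) *s v)"
          "\<lambda>(x, y). (a *s x + b *s y, b *s x + (- a) *s y)"])
       (simp_all only: split_paired_all prod.case inv1 inv2 inv3 inv4 rotate mult_1 UNIV_I)
  then show ?thesis by (simp only: square)
qed

text \<open>
  The Gauss sum of \<open>s Q\<close> depends only on the square class of \<open>s\<close>, there are two classes, and by the previous lemma their
  values agree up to sign. The first alternative is that of even dimension, the second that of odd dimension.
\<close>
lemma form_gauss_sum_cases:
  fixes Q :: "'a ^ 'n::finite \<Rightarrow> 'a"
  assumes Q: "quadratic_form Q"
  shows "(\<forall>s. s \<noteq> 0 \<longrightarrow> form_gauss_sum Q s = form_gauss_sum Q 1)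
       \<or> (\<forall>s. s \<noteq> 0 \<longrightarrow> form_gauss_sum Q s = \<eta> s * form_gauss_sum Q 1)"
proof (rule disjCI)
  have scale: "form_gauss_sum Q (s * c\<^sup>2) = form_gauss_sum Q s" if "c \<noteq> 0" for s c
    unfolding form_gauss_sum_def
    by (rule sum.reindex_bij_witness[of _ "\<lambda>x. (1 / c) *s x" "\<lambda>x. c *s x"])
       (use that in \<open>auto simp: quadratic_form_simps(1)[OF Q] mult.assoc\<close>)
  assume "\<not> (\<forall>s. s \<noteq> 0 \<longrightarrow> form_gauss_sum Q s = \<eta> s * form_gauss_sum Q 1)"
  then obtain r where r: "r \<noteq> 0" "form_gauss_sum Q r \<noteq> \<eta> r * form_gauss_sum Q 1" by blast
  have square: "form_gauss_sum Q s = form_gauss_sum Q r" if sr: "s \<noteq> 0" "r \<noteq> 0" "\<eta> s = \<eta> r" for s r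
  proof -
    have "\<eta> (s / r) * \<eta> r = \<eta> s" using sr by (simp flip: eta_mult)
    then have "\<eta> (s / r) = 1" using sr eta_cases[of r] by auto
    then obtain c where c: "s / r = c\<^sup>2" using eta_eq_1_imp_square[of "s / r"] sr(1,2) by (metis divide_eq_0_iff)
    then have "c \<noteq> 0" "s = r * c\<^sup>2" using sr by (auto simp: field_simps)
    then show ?thesis using scale by simp
  qed
  have "\<eta> r = - 1" using r square[of r 1] eta_cases[of r] by auto
  moreover have "form_gauss_sum Q r = form_gauss_sum Q 1"
    using form_gauss_sum_square[OF Q r(1)] r(2) \<open>\<eta> r = - 1\<close> by (auto simp: power2_eq_iff)
  ultimately show "\<forall>s. s \<noteq> 0 \<longrightarrow> form_gauss_sum Q s = form_gauss_sum Q 1"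
    using square[of _ r] square[of _ 1] r(1) eta_cases by (metis eta_1 zero_neq_one)
qed

text \<open>
  Completing the square replaces \<open>s Q h + polar_form Q m h\<close> by \<open>s Q (h + m/s) - Q m / s\<close>, so that the coefficient is
  \<open>1/q\<close> times a Kloosterman or a Salie sum with parameters \<open>-t\<close> and \<open>-Q m\<close>, times a Gauss sum of modulus \<open>q^(d/2)\<close>. The
  subtracted mean \<open>1/q\<close> is the term \<open>s = 0\<close> of the expansion, so the bound holds for \<open>m = 0\<close> too, where that term would
  contribute the average size of a level set.
\<close>
lemma form_fourier_coefficient_le:
  fixes Q :: "'a ^ 'n::finite \<Rightarrow> 'a"
  assumes nd: "nondegenerate_quadratic_form Q" and t: "t \<noteq> 0"
  shows "(norm (\<Sum>h\<in>UNIV. ((if Q h = t then 1 else 0) - 1 / of_nat CARD('a)) * \<psi> (polar_form Q m h)))\<^sup>2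
    \<le> 4 * real CARD('a) ^ (CARD('n) - 1)"
proof -
  let ?q = "real CARD('a)"
  have Q: "quadratic_form Q" using nd by (auto simp: nondegenerate_quadratic_form_def)
  note simps = quadratic_form_simps[OF Q]
  have q: "?q > 1" using card_ge_2 by simp
  define S where "S = (\<Sum>s\<in>-{0}. \<psi> (- t * s + - Q m / s) * form_gauss_sum Q s)"
  have "(\<Sum>h\<in>UNIV. ((if Q h = t then 1 else 0) - 1 / of_nat CARD('a)) * \<psi> (polar_form Q m h))
      = (\<Sum>h\<in>UNIV. (\<Sum>s\<in>-{0}. \<psi> ((Q h - t) * s)) / of_nat CARD('a) * \<psi> (polar_form Q m h))"
    unfolding indicator_minus_mean[symmetric] by simp
  also have "\<dots> = (\<Sum>h\<in>UNIV. \<Sum>s\<in>-{0}. \<psi> ((Q h - t) * s + polar_form Q m h)) / of_nat CARD('a)"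
    by (simp add: sum_divide_distrib sum_distrib_right psi_add)
  also have "(\<Sum>h\<in>UNIV. \<Sum>s\<in>-{0}. \<psi> ((Q h - t) * s + polar_form Q m h))
      = (\<Sum>s\<in>-{0}. \<Sum>h\<in>UNIV. \<psi> ((Q h - t) * s + polar_form Q m h))"
    by (rule sum.swap)
  also have "\<dots> = S"
    unfolding S_def
  proof (rule sum.cong)
    fix s :: 'a assume "s \<in> - {0}"
    then have s: "s \<noteq> 0" by simp
    have complete_square: "(Q h - t) * s + polar_form Q m h = (- t * s + - Q m / s) + s * Q (h + (1 / s) *s m)" for h
    proof -
      have "Q (h + (1 / s) *s m) = Q h + (1 / s)\<^sup>2 * Q m + 1 / s * polar_form Q m h"
        by (simp add: simps(1,2) bilinear_form_simps(4)[OF simps(4)] simps(3)[of h m])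
      then show ?thesis using s by (simp add: power2_eq_square field_simps)
    qed
    have "(\<Sum>h\<in>UNIV. \<psi> ((Q h - t) * s + polar_form Q m h))
        = \<psi> (- t * s + - Q m / s) * (\<Sum>h\<in>UNIV. \<psi> (s * Q (h + (1 / s) *s m)))"
      unfolding complete_square psi_add[of "- t * s + - Q m / s"] sum_distrib_left ..
    also have "(\<Sum>h\<in>UNIV. \<psi> (s * Q (h + (1 / s) *s m))) = form_gauss_sum Q s"
      unfolding form_gauss_sum_def
      by (rule sum.reindex_bij_witness[of _ "\<lambda>x. x - (1 / s) *s m" "\<lambda>h. h + (1 / s) *s m"]) auto
    finally show "(\<Sum>h\<in>UNIV. \<psi> ((Q h - t) * s + polar_form Q m h))
        = \<psi> (- t * s + - Q m / s) * form_gauss_sum Q s" .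
  qed simp
  finally have coefficient: "(\<Sum>h\<in>UNIV. ((if Q h = t then 1 else 0) - 1 / of_nat CARD('a)) * \<psi> (polar_form Q m h))
      = S / of_nat CARD('a)" .
  have G: "norm (form_gauss_sum Q 1) = sqrt (?q ^ CARD('n))"
    using norm_form_gauss_sum[OF nd] by simp
  have "norm S \<le> 2 * sqrt ?q * sqrt (?q ^ CARD('n))"
    using form_gauss_sum_cases[OF Q]
  proof
    assume *: "\<forall>s. s \<noteq> 0 \<longrightarrow> form_gauss_sum Q s = form_gauss_sum Q 1"
    have "S = (\<Sum>s\<in>-{0}. \<psi> (- t * s + - Q m / s)) * form_gauss_sum Q 1"
      unfolding S_def sum_distrib_right
    proof (rule sum.cong)
      fix s :: 'a assume "s \<in> - {0}"
      then have "form_gauss_sum Q s = form_gauss_sum Q 1" using * by blast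
      then show "\<psi> (- t * s + - Q m / s) * form_gauss_sum Q s
          = \<psi> (- t * s + - Q m / s) * form_gauss_sum Q 1" by (simp only:)
    qed simp
    then show ?thesis
      using norm_inverse_sum_le[of "- t" "- Q m"] t G by (simp add: norm_mult mult_right_mono)
  next
    assume *: "\<forall>s. s \<noteq> 0 \<longrightarrow> form_gauss_sum Q s = \<eta> s * form_gauss_sum Q 1"
    have "S = (\<Sum>s\<in>-{0}. \<eta> s * \<psi> (- t * s + - Q m / s)) * form_gauss_sum Q 1"
      unfolding S_def sum_distrib_right
    proof (rule sum.cong)
      fix s :: 'a assume "s \<in> - {0}"
      then have "form_gauss_sum Q s = \<eta> s * form_gauss_sum Q 1" using * by blast
      then show "\<psi> (- t * s + - Q m / s) * form_gauss_sum Q s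
          = \<eta> s * \<psi> (- t * s + - Q m / s) * form_gauss_sum Q 1" by (simp only: mult_ac)
    qed simp
    then show ?thesis
      using norm_salie_sum_le[of "- t" "- Q m"] t G by (simp add: norm_mult mult_right_mono)
  qed
  then have "(norm S)\<^sup>2 \<le> (2 * sqrt ?q * sqrt (?q ^ CARD('n)))\<^sup>2"
    by (intro power_mono) auto
  also have "\<dots> = 4 * ?q * ?q ^ CARD('n)" using q by (simp add: power_mult_distrib)
  finally have "(norm S)\<^sup>2 / ?q\<^sup>2 \<le> 4 * ?q * ?q ^ CARD('n) / ?q\<^sup>2"
    by (rule divide_right_mono) simp
  also have "\<dots> = 4 * ?q ^ (CARD('n) - 1)"
    using q by (simp add: power_eq_if[of ?q "CARD('n)"] power2_eq_square)
  finally show ?thesis unfolding coefficient by (simp add: norm_divide power_divide)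
qed

text \<open>
  A convolution acts on Fourier coefficients by multiplication; the Fourier transform is taken with respect to the
  polar form, and its normalisation cancels from both sides.
\<close>
lemma quadratic_operator_bound:
  fixes Q :: "'a ^ 'n::finite \<Rightarrow> 'a" and f :: "'a ^ 'n \<Rightarrow> complex"
  assumes nd: "nondegenerate_quadratic_form Q" and t: "t \<noteq> 0"
  shows "(\<Sum>x\<in>UNIV. (norm (\<Sum>y\<in>UNIV. ((if Q (x - y) = t then 1 else 0) - 1 / of_nat CARD('a)) * f y))\<^sup>2)
    \<le> 4 * real CARD('a) ^ (CARD('n) - 1) * (\<Sum>y\<in>UNIV. (norm (f y))\<^sup>2)"
proof -
  let ?q = "real CARD('a)" and ?d = "CARD('n)"
  have Q: "quadratic_form Q" "nondegenerate_form (polar_form Q)"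
    using nd by (auto simp: nondegenerate_quadratic_form_def)
  note bil = quadratic_form_simps(4)[OF Q(1)]
  define k where "k h = (if Q h = t then 1 else 0) - 1 / complex_of_nat CARD('a)" for h
  define M where "M x = (\<Sum>y\<in>UNIV. k (x - y) * f y)" for x
  define fourier where "fourier g m = (\<Sum>x\<in>UNIV. g x * \<psi> (polar_form Q m x))"
    for g :: "'a ^ 'n \<Rightarrow> complex" and m
  have parseval_Q: "(\<Sum>m\<in>UNIV. (norm (fourier g m))\<^sup>2) = ?q ^ ?d * (\<Sum>x\<in>UNIV. (norm (g x))\<^sup>2)" for g
    unfolding fourier_def by (rule parseval) (rule character_orthogonality[OF bil Q(2)])
  have convolution: "fourier M m = fourier k m * fourier f m" for m
  proof -
    have "fourier M m = (\<Sum>y\<in>UNIV. \<Sum>x\<in>UNIV. k (x - y) * f y * \<psi> (polar_form Q m x))"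
      unfolding fourier_def M_def sum_distrib_right by (rule sum.swap)
    also have "\<dots> = (\<Sum>y\<in>UNIV. \<Sum>h\<in>UNIV. (k h * \<psi> (polar_form Q m h)) * (f y * \<psi> (polar_form Q m y)))"
    proof (rule sum.cong)
      fix y :: "'a ^ 'n"
      show "(\<Sum>x\<in>UNIV. k (x - y) * f y * \<psi> (polar_form Q m x))
          = (\<Sum>h\<in>UNIV. (k h * \<psi> (polar_form Q m h)) * (f y * \<psi> (polar_form Q m y)))"
      proof (rule sum.reindex_bij_witness[of _ "\<lambda>h. h + y" "\<lambda>x. x - y"])
        fix x
        have "polar_form Q m x = polar_form Q m (x - y) + polar_form Q m y"
          using bilinear_form_simps(2)[OF bil, of m "x - y" y] by simp
        then show "k (x - y) * \<psi> (polar_form Q m (x - y)) * (f y * \<psi> (polar_form Q m y))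
            = k (x - y) * f y * \<psi> (polar_form Q m x)" by (simp add: psi_add)
      qed auto
    qed simp
    also have "\<dots> = fourier k m * fourier f m"
      unfolding fourier_def sum_product by (rule sum.swap)
    finally show ?thesis .
  qed
  have "?q ^ ?d * (\<Sum>x\<in>UNIV. (norm (M x))\<^sup>2) = (\<Sum>m\<in>UNIV. (norm (fourier k m))\<^sup>2 * (norm (fourier f m))\<^sup>2)"
    unfolding parseval_Q[symmetric] convolution by (simp add: norm_mult power_mult_distrib)
  also have "\<dots> \<le> (\<Sum>m\<in>UNIV. 4 * ?q ^ (?d - 1) * (norm (fourier f m))\<^sup>2)"
    using form_fourier_coefficient_le[OF nd t]
    by (intro sum_mono mult_right_mono) (simp_all add: fourier_def k_def)
  also have "\<dots> = ?q ^ ?d * (4 * ?q ^ (?d - 1) * (\<Sum>y\<in>UNIV. (norm (f y))\<^sup>2))"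
    unfolding sum_distrib_left[symmetric] parseval_Q by simp
  finally show ?thesis by (simp add: M_def k_def)
qed

end

theorem distance_operator_bound:
  fixes \<phi> :: "'a::{field,finite} ^ 'n::finite \<Rightarrow> 'a ^ 'n \<Rightarrow> 'a" and f :: "'a ^ 'n \<Rightarrow> real"
  assumes odd: "odd CARD('a)" and \<phi>: "distance_type \<phi>" and t: "t \<noteq> 0"
  shows "(\<Sum>x\<in>UNIV. (\<Sum>y\<in>UNIV. ((if \<phi> x y = t then 1 else 0) - 1 / real CARD('a)) * f y)\<^sup>2)
    \<le> 4 * real CARD('a) ^ (CARD('n) - 1) * (\<Sum>y\<in>UNIV. (f y)\<^sup>2)"
proof -
  obtain \<psi> :: "'a \<Rightarrow> complex" where "additive_character \<psi>"
    using additive_character_exists by blast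
  then interpret odd_field_character \<psi> using odd by unfold_locales
  have complex: "norm (\<Sum>y\<in>UNIV. ((if \<phi> x y = t then 1 else 0) - 1 / complex_of_nat CARD('a)) * of_real (f y))
      = \<bar>\<Sum>y\<in>UNIV. ((if \<phi> x y = t then 1 else 0) - 1 / real CARD('a)) * f y\<bar>" for x
  proof -
    have "(\<Sum>y\<in>UNIV. ((if \<phi> x y = t then 1 else 0) - 1 / complex_of_nat CARD('a)) * of_real (f y))
        = of_real (\<Sum>y\<in>UNIV. ((if \<phi> x y = t then 1 else 0) - 1 / real CARD('a)) * f y)"
      unfolding of_real_sum by (intro sum.cong refl) simp
    then show ?thesis by (simp only: norm_of_real)
  qed
  consider (bilinear) "bilinear_form \<phi>" "nondegenerate_form \<phi>"
    | (quadratic) Q where "nondegenerate_quadratic_form Q" "\<phi> = (\<lambda>x y. Q (x - y))"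
    using \<phi> by (auto simp: distance_type_def)
  then show ?thesis
  proof cases
    case bilinear
    have "(\<Sum>x\<in>UNIV. (\<Sum>y\<in>UNIV. ((if \<phi> x y = t then 1 else 0) - 1 / real CARD('a)) * f y)\<^sup>2)
        \<le> real CARD('a) ^ (CARD('n) - 1) * (\<Sum>y\<in>UNIV. (f y)\<^sup>2)"
      using bilinear_operator_bound[OF bilinear t, of "\<lambda>y. of_real (f y)"]
      unfolding complex by simp
    also have "\<dots> \<le> 4 * real CARD('a) ^ (CARD('n) - 1) * (\<Sum>y\<in>UNIV. (f y)\<^sup>2)"
      by (intro mult_right_mono sum_nonneg) auto
    finally show ?thesis .
  next
    case quadratic
    then show ?thesis
      using quadratic_operator_bound[OF quadratic(1) t, of "\<lambda>y. of_real (f y)"] complex by simp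
  qed
qed

section \<open>Counting paths\<close>

text \<open>
  The powers of the compressed adjacency operator, applied to the indicator of \<open>A\<close>: the value at \<open>x\<close> is the number of paths
  in \<open>A\<close> with \<open>k\<close> edges that start at \<open>x\<close> (\<open>path_weight_eq_card\<close>).
\<close>
fun path_weight :: "('v \<Rightarrow> 'v \<Rightarrow> 'a) \<Rightarrow> 'a \<Rightarrow> 'v set \<Rightarrow> nat \<Rightarrow> 'v \<Rightarrow> real" where
  "path_weight \<phi> t A 0 x = (if x \<in> A then 1 else 0)"
| "path_weight \<phi> t A (Suc k) x =
     (if x \<in> A then (\<Sum>y\<in>UNIV. (if \<phi> x y = t then 1 else 0) * path_weight \<phi> t A k y) else 0)"

lemma path_weight_outside: "x \<notin> A \<Longrightarrow> path_weight \<phi> t A k x = 0"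
  by (cases k) auto

lemma finite_path_embeddings:
  fixes A :: "'v::finite set"
  shows "finite (path_embeddings \<phi> t A k)"
  by (rule finite_subset[OF _ finite_lists_length_eq[of A "k + 1"]]) (auto simp: path_embeddings_def)

lemma path_weight_eq_card:
  fixes A :: "'v::finite set"
  shows "path_weight \<phi> t A k x = real (card {xs \<in> path_embeddings \<phi> t A k. hd xs = x})"
proof (induction k arbitrary: x)
  case 0
  have "{xs \<in> path_embeddings \<phi> t A 0. hd xs = x} = (if x \<in> A then {[x]} else {})"
    by (auto simp: path_embeddings_def length_Suc_conv)
  then show ?case by simp
next
  case (Suc k)
  let ?P = "\<lambda>k x. {xs \<in> path_embeddings \<phi> t A k. hd xs = x}"
  show ?case
  proof (cases "x \<in> A")
    case False
    have empty: "?P (Suc k) x = {}" using False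
      by (auto simp: path_embeddings_def length_Suc_conv)
    show ?thesis unfolding empty using False by simp
  next
    case True
    have "?P (Suc k) x = (#) x ` (\<Union>y\<in>{y. \<phi> x y = t}. ?P k y)"
    proof (intro Set.set_eqI iffI)
      fix xs assume xs: "xs \<in> ?P (Suc k) x"
      then obtain ys where ys: "xs = x # ys" "length ys = k + 1"
        by (auto simp: path_embeddings_def length_Suc_conv)
      have edge: "\<phi> ((x # ys) ! i) (ys ! i) = t" if "i < Suc k" for i
        using xs ys that by (auto simp: path_embeddings_def)
      have "ys \<in> path_embeddings \<phi> t A k"
        using xs ys edge[of "Suc _"] by (auto simp: path_embeddings_def)
      moreover have "\<phi> x (hd ys) = t"
        using edge[of 0] ys(2) by (cases ys) auto
      ultimately show "xs \<in> (#) x ` (\<Union>y\<in>{y. \<phi> x y = t}. ?P k y)" using ys(1) by blast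
    next
      fix xs assume "xs \<in> (#) x ` (\<Union>y\<in>{y. \<phi> x y = t}. ?P k y)"
      then obtain ys where ys: "xs = x # ys" "\<phi> x (hd ys) = t" "ys \<in> path_embeddings \<phi> t A k" by blast
      then have "hd ys = ys ! 0" by (cases ys) (auto simp: path_embeddings_def)
      then have "\<phi> ((x # ys) ! i) ((x # ys) ! (i + 1)) = t" if "i < Suc k" for i
        using ys that by (cases i) (auto simp: path_embeddings_def)
      then show "xs \<in> ?P (Suc k) x" using ys True by (auto simp: path_embeddings_def)
    qed
    then have "card (?P (Suc k) x) = card (\<Union>y\<in>{y. \<phi> x y = t}. ?P k y)"
      by (simp add: card_image)
    also have "\<dots> = (\<Sum>y | \<phi> x y = t. card (?P k y))"
      by (intro card_UN_disjoint) (auto simp: finite_path_embeddings)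
    finally have "real (card (?P (Suc k) x)) = (\<Sum>y | \<phi> x y = t. path_weight \<phi> t A k y)"
      by (simp add: Suc.IH)
    also have "\<dots> = (\<Sum>y\<in>UNIV. (if \<phi> x y = t then 1 else 0) * path_weight \<phi> t A k y)"
      by (rule sum.mono_neutral_cong_left) auto
    finally show ?thesis using True by simp
  qed
qed

lemma num_paths_eq_sum_path_weight:
  fixes A :: "'v::finite set"
  shows "real (num_paths \<phi> t A k) = (\<Sum>x\<in>A. path_weight \<phi> t A k x)"
proof -
  have "(\<Sum>x\<in>UNIV. card {xs \<in> path_embeddings \<phi> t A k. hd xs = x}) = num_paths \<phi> t A k"
    using sum.group[of "path_embeddings \<phi> t A k" UNIV hd "\<lambda>_. 1 :: nat"]
    by (simp add: finite_path_embeddings num_paths_def)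
  then have "real (num_paths \<phi> t A k) = (\<Sum>x\<in>UNIV. path_weight \<phi> t A k x)"
    unfolding path_weight_eq_card by (simp flip: of_nat_sum)
  also have "\<dots> = (\<Sum>x\<in>A. path_weight \<phi> t A k x)"
    by (rule sum.mono_neutral_right) (auto simp: path_weight_outside)
  finally show ?thesis .
qed

text \<open>
  The deviation \<open>w\<close> of the \<open>k\<close>-th iterate from \<open>a^k\<close> times the indicator \<open>i\<close> of \<open>A\<close> obeys a recursion: one more application of the
  operator multiplies its norm by at most \<open>a + \<Lambda>\<close> and adds \<open>a^k M i\<close>, of norm at most \<open>a^k \<Lambda>\<close> times that of \<open>i\<close>. The bound
  \<open>(a + \<Lambda>)^k - a^k\<close> solves this recursion exactly.
\<close>
lemma path_weight_deviation:
  fixes \<phi> :: "'v::finite \<Rightarrow> 'v \<Rightarrow> 'a" and A :: "'v set"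
  assumes q: "q > 0" and \<Lambda>: "\<Lambda> \<ge> 0"
    and bound: "\<And>f :: 'v \<Rightarrow> real.
      L2_set (\<lambda>x. \<Sum>y\<in>UNIV. ((if \<phi> x y = t then 1 else 0) - 1 / q) * f y) UNIV \<le> \<Lambda> * L2_set f UNIV"
  defines "a \<equiv> real (card A) / q" and "i \<equiv> \<lambda>x. if x \<in> A then 1 else 0"
  shows "L2_set (\<lambda>x. path_weight \<phi> t A k x - a ^ k * i x) UNIV
    \<le> sqrt (real (card A)) * ((a + \<Lambda>) ^ k - a ^ k)"
proof (induction k)
  case 0
  then show ?case by (simp add: i_def L2_set_def)
next
  case (Suc k)
  define M where "M f x = (\<Sum>y\<in>UNIV. ((if \<phi> x y = t then 1 else 0) - 1 / q) * f y)" for f :: "'v \<Rightarrow> real" and x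
  define w where "w x = path_weight \<phi> t A k x - a ^ k * i x" for x
  have a: "a \<ge> 0" using q by (simp add: a_def)
  have i_norm: "L2_set i UNIV = sqrt (real (card A))"
  proof -
    have "(\<Sum>x\<in>UNIV. (i x)\<^sup>2) = (\<Sum>x\<in>A. 1)" by (rule sum.mono_neutral_cong_right) (auto simp: i_def)
    then show ?thesis by (simp add: L2_set_def)
  qed
  have i_sum: "(\<Sum>y\<in>UNIV. i y) = real (card A)"
  proof -
    have "(\<Sum>x\<in>UNIV. i x) = (\<Sum>x\<in>A. 1)" by (rule sum.mono_neutral_cong_right) (auto simp: i_def)
    then show ?thesis by simp
  qed
  have restrict: "L2_set (\<lambda>x. i x * f x) UNIV \<le> L2_set f UNIV" for f :: "'v \<Rightarrow> real"
    unfolding L2_set_def by (intro real_sqrt_le_mono sum_mono) (auto simp: i_def)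
  have mean: "\<bar>\<Sum>y\<in>UNIV. w y\<bar> \<le> sqrt (real (card A)) * L2_set w UNIV"
  proof -
    have "\<bar>\<Sum>y\<in>UNIV. w y\<bar> = \<bar>\<Sum>y\<in>UNIV. i y * w y\<bar>"
      by (intro arg_cong[where f = abs] sum.cong) (auto simp: i_def w_def path_weight_outside)
    also have "\<dots> \<le> (\<Sum>y\<in>UNIV. \<bar>i y\<bar> * \<bar>w y\<bar>)"
      unfolding abs_mult[symmetric] by (rule sum_abs)
    also have "\<dots> \<le> L2_set i UNIV * L2_set w UNIV" by (rule L2_set_mult_ineq)
    finally show ?thesis by (simp only: i_norm)
  qed
  \<comment> \<open>The mean part maps \<open>i\<close> to \<open>a * i\<close>, which is the main term; three error terms remain.\<close>
  have step: "path_weight \<phi> t A (Suc k) x - a ^ Suc k * i x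
      = a ^ k * (i x * M i x) + (i x * M w x + (\<Sum>y\<in>UNIV. w y) / q * i x)" for x
  proof (cases "x \<in> A")
    case True
    have pw: "path_weight \<phi> t A k y = a ^ k * i y + w y" for y by (simp add: w_def)
    have "path_weight \<phi> t A (Suc k) x = (\<Sum>y\<in>UNIV. (if \<phi> x y = t then 1 else 0) * (a ^ k * i y + w y))"
      using True by (simp add: pw)
    also have "\<dots> = (\<Sum>y\<in>UNIV. a ^ k * (((if \<phi> x y = t then 1 else 0) - 1 / q) * i y)
        + ((if \<phi> x y = t then 1 else 0) - 1 / q) * w y + a ^ k / q * i y + 1 / q * w y)"
      by (intro sum.cong refl) (simp add: algebra_simps)
    also have "\<dots> = a ^ k * M i x + M w x + a ^ k / q * real (card A) + 1 / q * (\<Sum>y\<in>UNIV. w y)"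
      unfolding M_def i_sum[symmetric] by (simp only: sum.distrib sum_distrib_left)
    finally show ?thesis using True by (simp add: i_def a_def)
  qed (simp add: i_def)
  have "L2_set (\<lambda>x. path_weight \<phi> t A (Suc k) x - a ^ Suc k * i x) UNIV
      \<le> L2_set (\<lambda>x. a ^ k * (i x * M i x)) UNIV
        + (L2_set (\<lambda>x. i x * M w x) UNIV + L2_set (\<lambda>x. (\<Sum>y\<in>UNIV. w y) / q * i x) UNIV)"
    unfolding step by (intro order_trans[OF L2_set_triangle_ineq] add_left_mono L2_set_triangle_ineq)
  also have "L2_set (\<lambda>x. a ^ k * (i x * M i x)) UNIV \<le> a ^ k * (\<Lambda> * sqrt (real (card A)))"
  proof -
    have "L2_set (\<lambda>x. i x * M i x) UNIV \<le> \<Lambda> * sqrt (real (card A))"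
      using restrict[of "M i"] bound[of i] i_norm unfolding M_def by simp
    then show ?thesis using a by (simp add: mult_left_mono flip: L2_set_right_distrib)
  qed
  also have "L2_set (\<lambda>x. i x * M w x) UNIV \<le> \<Lambda> * L2_set w UNIV"
    using restrict[of "M w"] bound[of w] unfolding M_def by simp
  also have "L2_set (\<lambda>x. (\<Sum>y\<in>UNIV. w y) / q * i x) UNIV \<le> a * L2_set w UNIV"
  proof -
    have "L2_set (\<lambda>x. (\<Sum>y\<in>UNIV. w y) / q * i x) UNIV = \<bar>\<Sum>y\<in>UNIV. w y\<bar> / q * sqrt (real (card A))"
    proof -
      have "L2_set (\<lambda>x. (\<Sum>y\<in>UNIV. w y) / q * i x) UNIV = L2_set (\<lambda>x. \<bar>\<Sum>y\<in>UNIV. w y\<bar> / q * i x) UNIV"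
        by (simp add: L2_set_def power_mult_distrib power_divide)
      also have "\<dots> = \<bar>\<Sum>y\<in>UNIV. w y\<bar> / q * L2_set i UNIV"
        using q by (intro L2_set_right_distrib[symmetric]) simp
      finally show ?thesis by (simp only: i_norm)
    qed
    also have "\<dots> \<le> (sqrt (real (card A)) * L2_set w UNIV) / q * sqrt (real (card A))"
      using q by (intro mult_right_mono divide_right_mono mean) auto
    also have "\<dots> = a * L2_set w UNIV" by (simp add: a_def)
    finally show ?thesis .
  qed
  also have "a ^ k * (\<Lambda> * sqrt (real (card A))) + (\<Lambda> * L2_set w UNIV + a * L2_set w UNIV)
      = a ^ k * (\<Lambda> * sqrt (real (card A))) + (a + \<Lambda>) * L2_set w UNIV" by (simp add: algebra_simps)
  also have "\<dots> \<le> a ^ k * (\<Lambda> * sqrt (real (card A)))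
      + (a + \<Lambda>) * (sqrt (real (card A)) * ((a + \<Lambda>) ^ k - a ^ k))"
    using Suc a \<Lambda> by (intro add_left_mono mult_left_mono) (auto simp: w_def[abs_def])
  also have "\<dots> = sqrt (real (card A)) * ((a + \<Lambda>) ^ Suc k - a ^ Suc k)" by (simp add: algebra_simps)
  finally show ?case by simp
qed

text \<open>
  \<open>(1 + u)^k \<le> exp (k u)\<close>, and on the interval from \<open>0\<close> to \<open>ln 2\<close> the exponential function lies below its chord,
  which rises from \<open>1\<close> to \<open>2\<close>.
\<close>
lemma power_one_plus_minus_one_le:
  fixes u :: real
  assumes "u \<ge> 0" "real k * u \<le> ln 2"
  shows "(1 + u) ^ k - 1 \<le> real k * u / ln 2"
proof -
  define s where "s = real k * u / ln 2"
  have s: "0 \<le> s" "s \<le> 1" using assms by (simp_all add: s_def)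
  have "(1 + u) ^ k \<le> exp u ^ k" using assms by (intro power_mono) auto
  also have "\<dots> = exp ((1 - s) *\<^sub>R 0 + s *\<^sub>R ln 2)" by (simp add: s_def exp_of_nat_mult)
  also have "\<dots> \<le> (1 - s) * exp 0 + s * exp (ln 2)"
    using exp_convex s by (intro convex_onD[of UNIV]) auto
  also have "\<dots> = 1 + s" by simp
  finally show ?thesis by (simp add: s_def)
qed

theorem theorem4p1:
  fixes \<phi> :: "'a::{field,finite} ^ 'n::finite \<Rightarrow> 'a ^ 'n \<Rightarrow> 'a"
    and A :: "('a ^ 'n) set"
    and t :: 'a
    and q d k :: nat
  assumes "q = CARD('a)" and "odd q"
    and "d = CARD('n)" and "d \<ge> 2"
    and "k \<ge> 1"
    and "distance_type \<phi>"
    and "t \<noteq> 0"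
    and "real (card A) > 2 * real k / ln 2 * real q powr ((real d + 1) / 2)"
  shows "\<bar>real (num_paths \<phi> t A k) - real (card A) ^ (k + 1) / real q ^ k\<bar>
     \<le> 2 * real k / ln 2 * real q powr ((real d + 1) / 2) * (real (card A) ^ k / real q ^ k)"
proof -
  define N where "N = real (card A)"
  define \<Lambda> where "\<Lambda> = 2 * sqrt (real q ^ (d - 1))"
  define D where "D = real q powr ((real d + 1) / 2)"
  define a where "a = N / real q"
  define i where "i x = (if x \<in> A then 1 else 0 :: real)" for x
  have q: "real q > 0" using assms(1) by simp
  have \<Lambda>: "\<Lambda> \<ge> 0" by (simp add: \<Lambda>_def)
  have D: "D > 0" using q by (simp add: D_def)
  have large: "N > 2 * real k / ln 2 * D" using assms(8) by (simp add: N_def D_def)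
  then have N: "N > 0" using D by (smt (verit) divide_nonneg_pos ln_gt_zero mult_nonneg_nonneg of_nat_0_le_iff)
  have a: "a > 0" using N q by (simp add: a_def)
  have \<Lambda>_q: "\<Lambda> * real q = 2 * D"
  proof -
    have "sqrt (real q ^ (d - 1)) = real q powr ((real d - 1) / 2)"
      using q assms(4) by (simp add: powr_half_sqrt[symmetric] powr_powr flip: powr_realpow)
    then have "\<Lambda> * real q = 2 * (real q powr ((real d - 1) / 2) * real q powr 1)"
      using q by (simp add: \<Lambda>_def)
    also have "real q powr ((real d - 1) / 2) * real q powr 1 = D"
      unfolding D_def powr_add[symmetric] by (simp add: field_simps)
    finally show ?thesis .
  qed
  have bound: "L2_set (\<lambda>x. \<Sum>y\<in>UNIV. ((if \<phi> x y = t then 1 else 0) - 1 / real q) * f y) UNIV \<le> \<Lambda> * L2_set f UNIV"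
    for f :: "'a ^ 'n \<Rightarrow> real"
  proof -
    have "(\<Sum>x\<in>UNIV. (\<Sum>y\<in>UNIV. ((if \<phi> x y = t then 1 else 0) - 1 / real q) * f y)\<^sup>2)
        \<le> 4 * real q ^ (d - 1) * (\<Sum>y\<in>UNIV. (f y)\<^sup>2)"
      using distance_operator_bound[of \<phi> t f] assms by simp
    then have "sqrt (\<Sum>x\<in>UNIV. (\<Sum>y\<in>UNIV. ((if \<phi> x y = t then 1 else 0) - 1 / real q) * f y)\<^sup>2)
        \<le> sqrt (4 * real q ^ (d - 1) * (\<Sum>y\<in>UNIV. (f y)\<^sup>2))"
      by (rule real_sqrt_le_mono)
    also have "\<dots> = \<Lambda> * sqrt (\<Sum>y\<in>UNIV. (f y)\<^sup>2)" by (simp add: \<Lambda>_def real_sqrt_mult)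
    finally show ?thesis by (simp add: L2_set_def)
  qed
  define w where "w x = path_weight \<phi> t A k x - a ^ k * i x" for x
  have dev: "L2_set w UNIV \<le> sqrt N * ((a + \<Lambda>) ^ k - a ^ k)"
    unfolding w_def a_def i_def N_def by (rule path_weight_deviation[OF q \<Lambda> bound])
  have "real (num_paths \<phi> t A k) - N ^ (k + 1) / real q ^ k = (\<Sum>x\<in>A. w x)"
    by (simp add: num_paths_eq_sum_path_weight w_def i_def sum_subtractf a_def N_def power_divide)
  also have "\<bar>\<dots>\<bar> \<le> (\<Sum>x\<in>A. \<bar>1\<bar> * \<bar>w x\<bar>)" using sum_abs[of w A] by simp
  also have "\<dots> \<le> L2_set (\<lambda>_. 1) A * L2_set w A" by (rule L2_set_mult_ineq)
  also have "\<dots> \<le> sqrt N * L2_set w UNIV"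
  proof -
    have "L2_set w A \<le> L2_set w UNIV"
      unfolding L2_set_def by (intro real_sqrt_le_mono sum_mono2) auto
    then show ?thesis by (simp add: L2_set_def N_def mult_left_mono)
  qed
  also have "\<dots> \<le> sqrt N * (sqrt N * ((a + \<Lambda>) ^ k - a ^ k))"
    by (intro mult_left_mono dev) (use N in auto)
  also have "\<dots> = N * ((a + \<Lambda>) ^ k - a ^ k)" using N by (simp flip: mult.assoc)
  also have "\<dots> = N * a ^ k * ((1 + \<Lambda> / a) ^ k - 1)"
  proof -
    have "a + \<Lambda> = a * (1 + \<Lambda> / a)" using a by (simp add: distrib_left)
    then have "(a + \<Lambda>) ^ k = a ^ k * (1 + \<Lambda> / a) ^ k" by (simp only: power_mult_distrib)
    then show ?thesis by (simp add: algebra_simps)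
  qed
  also have "\<dots> \<le> N * a ^ k * (real k * (\<Lambda> / a) / ln 2)"
  proof (intro mult_left_mono power_one_plus_minus_one_le)
    have ratio: "\<Lambda> / a = 2 * D / N" using \<Lambda>_q q by (simp add: a_def)
    show "real k * (\<Lambda> / a) \<le> ln 2"
      unfolding ratio using large N by (simp add: field_simps)
  qed (use \<Lambda> N q in \<open>auto simp: a_def\<close>)
  also have "\<dots> = 2 * real k / ln 2 * D * (N ^ k / real q ^ k)"
  proof -
    have ratio: "\<Lambda> / a = 2 * D / N" using \<Lambda>_q q by (simp add: a_def)
    show ?thesis unfolding ratio using N by (simp add: a_def power_divide mult_ac)
  qed
  finally show ?thesis by (simp add: N_def D_def)
qed

end
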